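(* Let $U\subset\mathbb R^d$ be open and $\mathbf f:U\to\mathbb R^n$ continuous and good. The following are equivalent: (i) the set $\{\mathbf x\in U:\mathbf f(\mathbf x)\text{ is not VWMA}\}$ is dense in $U$; (ii) $\mathbf f$ is strongly extremal; (iii) for a.e. $\mathbf x_0\in U$ and every $r>0$ there is a ball $B\subset U$ centered at $\mathbf x_0$ of radius less than $r$ satisfying condition ( ** ); (iv) every ball $B\subset U$ satisfies ( ** ). Here condition ( ** ) for a ball $B$ is: for every $\beta>0$ there exists $T>0$ such that for every $\mathbf t\in\mathbb R^n_{\ge0}$ with $t\ge T$ and every $\Gamma\in\mathcal S_{n+1}$, $\sup_{\mathbf x\in B}\|g_{\mathbf t}u_{\mathbf f(\mathbf x)}\Gamma\|\ge e^{-\beta t}$.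
   Context: A function $f:V\to\mathbb R$ is $(C,\alpha)$-good on $V$ if for every open ball $B\subset V$ and $\varepsilon>0$, $|\{\mathbf x\in B:|f(\mathbf x)|<\varepsilon\sup_B|f|\}|\le C\varepsilon^\alpha|B|$. $\mathbf f=(f_1,\dots,f_n)$ is good at $\mathbf x_0$ if there are a neighborhood $V$ of $\mathbf x_0$ and $C,\alpha>0$ such that every linear combination of $1,f_1,\dots,f_n$ is $(C,\alpha)$-good on $V$; $\mathbf f$ is good if good at a.e. point. $\Pi_+(\mathbf x)=\prod\max(|x_i|,1)$; $\mathbf y\in\mathbb R^n$ is VWMA if for some $v>n$ there are infinitely many $\mathbf q\in\mathbb Z^n$ with $|\mathbf y\mathbf q+p|\le\Pi_+(\mathbf q)^{-v/n}$, $p\in\mathbb Z$; $\mathbf f$ is strongly extremal if $\mathbf f(\mathbf x)$ is not VWMA for a.e. $\mathbf x$. For $\mathbf t\in\mathbb R^n_{\ge0}$, $t=\sum t_i$, $g_{\mathbf t}=\mathrm{diag}(e^t,e^{-t_1},\dots,e^{-t_n})$; $u_{\mathbf y}=\begin{pmatrix}1&\mathbf y\\0&I_n\end{pmatrix}$. With $\mathbf e_I$ the wedge of standard basis vectors $\mathbf e_i$, $i\in I\subset\{0,\dots,n\}$ (increasing), $\|\sum w_I\mathbf e_I\|=\max|w_I|$; $\mathcal S_{n+1}$ is the set of nonzero subgroups of $\mathbb Z^{n+1}$ of rank $\le n$, and for $\Gamma$ with basis $\mathbf v_1,\dots,\mathbf v_j$, $\|g\Gamma\|=\|g\mathbf v_1\wedge\dots\wedge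 g\mathbf v_j\|$. *)

theory Defs
  imports "HOL-Analysis.Analysis"
begin

text \<open>Conventions. The domain R^d is an abstract euclidean space 'a (d = DIM('a)).
Vectors of R^n are functions nat => real, only components 1..n being relevant;
vectors of R^(n+1) are functions nat => real with components 0..n (e_0,...,e_n).\<close>

definition good_on :: "real \<Rightarrow> real \<Rightarrow> 'a::euclidean_space set \<Rightarrow> ('a \<Rightarrow> real) \<Rightarrow> bool" where
  "good_on C \<alpha> V h \<longleftrightarrow>
     (\<forall>z r. 0 < r \<longrightarrow> ball z r \<subseteq> V \<longrightarrow>
       (\<forall>\<epsilon>>0. measure lebesgue {x \<in> ball z r. ereal \<bar>h x\<bar> < ereal \<epsilon> * (SUP y\<in>ball z r. ereal \<bar>h y\<bar>)}
                 \<le> C * \<epsilon> powr \<alpha> * measure lebesgue (ball z r)))"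

definition good_at :: "nat \<Rightarrow> 'a::euclidean_space set \<Rightarrow> ('a \<Rightarrow> nat \<Rightarrow> real) \<Rightarrow> 'a \<Rightarrow> bool" where
  "good_at n U f x0 \<longleftrightarrow>
     (\<exists>V C \<alpha>. open V \<and> x0 \<in> V \<and> V \<subseteq> U \<and> C > 0 \<and> \<alpha> > 0 \<and>
        (\<forall>(c0::real) (c::nat \<Rightarrow> real). good_on C \<alpha> V (\<lambda>x. c0 + (\<Sum>i=1..n. c i * f x i))))"

definition good :: "nat \<Rightarrow> 'a::euclidean_space set \<Rightarrow> ('a \<Rightarrow> nat \<Rightarrow> real) \<Rightarrow> bool" where
  "good n U f \<longleftrightarrow> (AE x in lebesgue. x \<in> U \<longrightarrow> good_at n U f x)"

definition Pi_plus :: "nat \<Rightarrow> (nat \<Rightarrow> int) \<Rightarrow> real" where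
  "Pi_plus n q = (\<Prod>i=1..n. max \<bar>real_of_int (q i)\<bar> 1)"

definition int_vecs :: "nat \<Rightarrow> (nat \<Rightarrow> int) set" where
  "int_vecs n = {q. \<forall>i. i \<notin> {1..n} \<longrightarrow> q i = 0}"

definition VWMA :: "nat \<Rightarrow> (nat \<Rightarrow> real) \<Rightarrow> bool" where
  "VWMA n y \<longleftrightarrow> (\<exists>v > real n. infinite {q \<in> int_vecs n. \<exists>p::int.
      \<bar>(\<Sum>i=1..n. y i * of_int (q i)) + of_int p\<bar> \<le> Pi_plus n q powr (- v / real n)})"

definition strongly_extremal :: "nat \<Rightarrow> 'a::euclidean_space set \<Rightarrow> ('a \<Rightarrow> nat \<Rightarrow> real) \<Rightarrow> bool" where
  "strongly_extremal n U f \<longleftrightarrow> (AE x in lebesgue. x \<in> U \<longrightarrow> \<not> VWMA n (f x))"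

definition gu_act :: "nat \<Rightarrow> (nat \<Rightarrow> real) \<Rightarrow> (nat \<Rightarrow> real) \<Rightarrow> (nat \<Rightarrow> real) \<Rightarrow> (nat \<Rightarrow> real)" where
  "gu_act n t y v = (\<lambda>i. if i = 0 then exp (\<Sum>j=1..n. t j) * (v 0 + (\<Sum>j=1..n. y j * v j))
                        else if i \<le> n then exp (- t i) * v i else 0)"

definition ldet :: "nat \<Rightarrow> (nat \<Rightarrow> nat \<Rightarrow> real) \<Rightarrow> real" where
  "ldet k A = (\<Sum>p | p permutes {..<k}. of_int (sign p) * (\<Prod>a<k. A a (p a)))"

text \<open>Sup-norm of v_1 wedge ... wedge v_k in the basis e_I, I subset {0..n} increasing:
 the coordinate at e_I is the minor with rows I.\<close>
definition wedge_norm :: "nat \<Rightarrow> (nat \<Rightarrow> real) list \<Rightarrow> real" where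
  "wedge_norm n vs = Max ((\<lambda>I. \<bar>ldet (length vs) (\<lambda>a b. (vs ! b) (sorted_list_of_set I ! a))\<bar>)
                          ` {I. I \<subseteq> {0..n} \<and> card I = length vs})"

text \<open>Bases of the elements of S_(n+1): lists of j vectors of Z^(n+1), 1 <= j <= n,
 linearly independent; the subgroup is the one they generate.\<close>
definition S_basis :: "nat \<Rightarrow> (nat \<Rightarrow> int) list \<Rightarrow> bool" where
  "S_basis n vs \<longleftrightarrow> 1 \<le> length vs \<and> length vs \<le> n \<and>
     (\<forall>v \<in> set vs. \<forall>i > n. v i = 0) \<and>
     (\<forall>c::nat \<Rightarrow> real. (\<forall>i. (\<Sum>k<length vs. c k * of_int ((vs ! k) i)) = 0) \<longrightarrow> (\<forall>k<length vs. c k = 0))"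

definition gu_norm :: "nat \<Rightarrow> (nat \<Rightarrow> real) \<Rightarrow> (nat \<Rightarrow> real) \<Rightarrow> (nat \<Rightarrow> int) list \<Rightarrow> real" where
  "gu_norm n t y vs = wedge_norm n (map (\<lambda>v. gu_act n t y (\<lambda>i. of_int (v i))) vs)"

definition cond_star :: "nat \<Rightarrow> ('a \<Rightarrow> nat \<Rightarrow> real) \<Rightarrow> 'a set \<Rightarrow> bool" where
  "cond_star n f B \<longleftrightarrow>
     (\<forall>\<beta>>0. \<exists>T>0. \<forall>t::nat \<Rightarrow> real. (\<forall>i\<in>{1..n}. 0 \<le> t i) \<longrightarrow> (\<Sum>i=1..n. t i) \<ge> T \<longrightarrow>
        (\<forall>vs. S_basis n vs \<longrightarrow>
           (SUP x\<in>B. ereal (gu_norm n t (f x) vs)) \<ge> ereal (exp (- \<beta> * (\<Sum>i=1..n. t i)))))"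

end

theory Submission
  imports Defs "Jordan_Normal_Form.Determinant"
begin

text \<open>From (iii) to (ii): the Dani correspondence turns very good approximations of \<open>f x\<close> into nonzero
  integer vectors that \<open>g u\<close> (with parameters \<open>t\<close> and \<open>f x\<close>) contracts to length at most
  \<open>exp (- \<gamma> t)\<close>. By condition (**) and the quantitative nondivergence argument of Kleinbock and
  Margulis, the points with such a vector have measure at most a constant times \<open>exp (- \<kappa> t)\<close>, and
  the Borel--Cantelli lemma applies. The nondivergence argument grows a flag of subgroups on smaller
  and smaller balls. Vitali's covering lemma suffices because good functions are doubling, and with
  balls of almost maximal radius neither primitive subgroups nor discreteness are needed.

  From (i) to (iv): if a single \<open>f x\<close> in a ball is not VWMA, then \<open>g u\<close> keeps all nonzero integer
  vectors longer than \<open>exp (- \<beta> t)\<close> for large \<open>t\<close>, and Hermite's reduction bounds the covolume of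
  every subgroup from below by a power of its shortest length.\<close>

section \<open>Determinants\<close>

text \<open>The implications form the cycle (iv), (iii), (ii), (i), (iv); (iv) to (iii) shrinks a
  ball, and (ii) to (i) holds because nonempty open sets have positive measure. The obstacle in
  (iii) to (ii) is uniformity: there are infinitely many subgroups and infinitely many directions of
  t, and the measure bound may depend on neither. Every coordinate of a transformed subgroup is an
  affine combination of 1, f_1, ..., f_n, so all covolumes are good with the same constants. The
  times t may be taken integral; at most (k+1)^n of them have sum k, and the exponential gain beats
  this count. A flag at x certifies the absence of short vectors: its members have covolumes that
  are neither large nor tiny, and every subgroup that could extend it has covolume at least \<rho>.
  Adjoining an integer vector v to the longest member whose span omits v gives a subgroup that
  extends the flag, spans the same space as a member, or has full rank. In each case its covolume is
  bounded below, and comparison with the member bounds the length of v below.\<close>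

lemma ldet_eq_det: "ldet k A = det (mat k k (\<lambda>(i, j). A i j))"
proof -
  have "(\<Prod>a<k. A a (p a)) = (\<Prod>i = 0..<k. mat k k (\<lambda>(i, j). A i j) $$ (i, p i))"
    if "p permutes {..<k}" for p
    unfolding atLeast0LessThan
    by (rule prod.cong) (use that permutes_in_image in fastforce)+
  then show ?thesis
    by (subst det_def'[of _ k]) (auto simp: ldet_def atLeast0LessThan intro!: sum.cong)
qed

lemma ldet_cong:
  assumes "\<And>a b. a < k \<Longrightarrow> b < k \<Longrightarrow> A a b = B a b"
  shows "ldet k A = ldet k B"
  unfolding ldet_eq_det by (rule arg_cong[of _ _ det], rule eq_matI) (auto simp: assms)

lemma ldet_mult: "ldet k (\<lambda>a b. \<Sum>c<k. A a c * C c b) = ldet k A * ldet k C"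
  unfolding ldet_eq_det
  by (subst det_mult[symmetric, of _ k], simp, simp, rule arg_cong[of _ _ det], rule eq_matI)
     (auto simp: scalar_prod_def atLeast0LessThan)

lemma ldet_addcol:
  assumes "i < k" "j < k" "i \<noteq> j"
  shows "ldet k (\<lambda>a b. if b = i then A a i + x * A a j else A a b) = ldet k A"
proof -
  have "ldet k A = det (addcol x i j (mat k k (\<lambda>(i, j). A i j)))"
    unfolding ldet_eq_det using assms by (intro det_addcol[symmetric]) auto
  also have "\<dots> = ldet k (\<lambda>a b. if b = i then A a i + x * A a j else A a b)"
    unfolding ldet_eq_det using assms
    by (intro arg_cong[of _ _ det] eq_matI) (auto simp: mat_addcol_def)
  finally show ?thesis by simp
qed

text \<open>The increasing enumeration of the naturals other than \<open>i\<close>: the reindexing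
  caused by deleting row \<open>i\<close> of a matrix or entry \<open>i\<close> of a list.\<close>

definition skip :: "nat \<Rightarrow> nat \<Rightarrow> nat" where
  "skip i a = (if a < i then a else Suc a)"

lemma ldet_laplace:
  "ldet (Suc k) A = (\<Sum>i<Suc k. (-1) ^ i * A i 0 * ldet k (\<lambda>a b. A (skip i a) (Suc b)))"
proof -
  let ?M = "mat (Suc k) (Suc k) (\<lambda>(i, j). A i j)"
  have "cofactor ?M i 0 = (-1) ^ i * ldet k (\<lambda>a b. A (skip i a) (Suc b))" if "i < Suc k" for i
    unfolding ldet_eq_det cofactor_def mat_delete_def using that
    by (auto intro!: arg_cong[of _ _ det] eq_matI simp: skip_def)
  then show ?thesis
    unfolding ldet_eq_det
    by (subst laplace_expansion_column[of _ "Suc k" 0])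
       (auto intro!: sum.cong simp: ldet_eq_det[symmetric] simp del: sum.lessThan_Suc)
qed

lemma ldet_eq_0_kernel:
  assumes "ldet k A = 0"
  obtains c where "\<exists>b<k. c b \<noteq> (0::real)" "\<And>a. a < k \<Longrightarrow> (\<Sum>b<k. A a b * c b) = 0"
proof -
  let ?M = "mat k k (\<lambda>(i, j). A i j)"
  obtain v where v: "v \<in> carrier_vec k" "v \<noteq> 0\<^sub>v k" "?M *\<^sub>v v = 0\<^sub>v k"
    using assms det_0_iff_vec_prod_zero[of ?M k] unfolding ldet_eq_det by auto
  show ?thesis
  proof (rule that[of "\<lambda>b. v $ b"])
    show "\<exists>b<k. v $ b \<noteq> 0"
      using v(1,2) by (metis carrier_vecD eq_vecI index_zero_vec(1,2))
    show "(\<Sum>b<k. A a b * v $ b) = 0" if "a < k" for a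
    proof -
      have "(?M *\<^sub>v v) $ a = 0"
        unfolding v(3) using that by simp
      then show ?thesis
        using that v(1) by (simp add: mult_mat_vec_def scalar_prod_def atLeast0LessThan)
    qed
  qed
qed

text \<open>The inverse is the adjugate divided by the determinant.\<close>

lemma ldet_nonzero_inverse:
  assumes "ldet k A \<noteq> 0"
  obtains B where "\<And>a b. a < k \<Longrightarrow> b < k \<Longrightarrow> (\<Sum>c<k. A a c * B c b) = (if a = b then 1 else 0)"
proof -
  let ?M = "mat k k (\<lambda>(i, j). A i j)"
  define N where "N = adj_mat ?M"
  have N: "N \<in> carrier_mat k k" "?M * N = ldet k A \<cdot>\<^sub>m 1\<^sub>m k"
    using adj_mat[of ?M k] unfolding N_def ldet_eq_det by auto
  show ?thesis
  proof (rule that[of "\<lambda>c b. N $$ (c, b) / ldet k A"])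
    fix a b assume ab: "a < k" "b < k"
    have "(\<Sum>c<k. A a c * N $$ (c, b)) = (?M * N) $$ (a, b)"
      using ab N(1) by (simp add: scalar_prod_def atLeast0LessThan)
    also have "\<dots> = (if a = b then ldet k A else 0)"
      unfolding N(2) using ab by simp
    finally show "(\<Sum>c<k. A a c * (N $$ (c, b) / ldet k A)) = (if a = b then 1 else 0)"
      using assms by (simp flip: sum_divide_distrib)
  qed
qed

lemma ldet_upper_triangular:
  assumes "\<And>a b. b < a \<Longrightarrow> a < k \<Longrightarrow> A a b = 0"
  shows "ldet k A = (\<Prod>a<k. A a a)"
  unfolding ldet_eq_det using assms
  by (subst det_upper_triangular[of _ k]) (auto simp: prod_list_diag_prod atLeast0LessThan)

lemma ldet_zero_row:
  assumes "a < k" "\<And>b. b < k \<Longrightarrow> A a b = 0"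
  shows "ldet k A = 0"
proof -
  have "(\<Prod>a<k. A a (p a)) = 0" if "p permutes {..<k}" for p
    using assms permutes_in_image[OF that, of a] by (auto intro!: prod_zero bexI[of _ a])
  then show ?thesis
    unfolding ldet_def by (intro sum.neutral) simp
qed

section \<open>Exterior powers and sup-norm reduction\<close>

definition minor :: "(nat \<Rightarrow> real) list \<Rightarrow> nat set \<Rightarrow> real" where
  "minor vs I = ldet (length vs) (\<lambda>a b. (vs ! b) (sorted_list_of_set I ! a))"

definition vnorm :: "nat \<Rightarrow> (nat \<Rightarrow> real) \<Rightarrow> real" where
  "vnorm n v = Max ((\<lambda>i. \<bar>v i\<bar>) ` {0..n})"

lemma abs_le_vnorm: "i \<le> n \<Longrightarrow> \<bar>v i\<bar> \<le> vnorm n v"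
  unfolding vnorm_def by (rule Max_ge) auto

lemma vnorm_leI: "(\<And>i. i \<le> n \<Longrightarrow> \<bar>v i\<bar> \<le> c) \<Longrightarrow> vnorm n v \<le> c"
  unfolding vnorm_def by (subst Max_le_iff) auto

lemma vnorm_attained: obtains i where "i \<le> n" "vnorm n v = \<bar>v i\<bar>"
proof -
  have "vnorm n v \<in> (\<lambda>i. \<bar>v i\<bar>) ` {0..n}"
    unfolding vnorm_def by (rule Max_in) auto
  then show ?thesis using that by auto
qed

lemma vnorm_nonneg: "0 \<le> vnorm n v"
  using abs_le_vnorm[of 0 n v] by linarith

lemma wedge_norm_minor:
  "wedge_norm n vs = Max ((\<lambda>I. \<bar>minor vs I\<bar>) ` {I. I \<subseteq> {0..n} \<and> card I = length vs})"
  by (simp add: wedge_norm_def minor_def)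

lemma finite_card_subsets: "finite {I. I \<subseteq> {0..n::nat} \<and> card I = k}"
  by (rule finite_subset[of _ "Pow {0..n}"]) auto

lemma abs_minor_le_wedge_norm:
  assumes "I \<subseteq> {0..n}" "card I = length vs"
  shows "\<bar>minor vs I\<bar> \<le> wedge_norm n vs"
  unfolding wedge_norm_minor using assms finite_card_subsets by (intro Max_ge) auto

lemma wedge_norm_attained:
  assumes "length vs \<le> Suc n"
  obtains I where "I \<subseteq> {0..n}" "card I = length vs" "wedge_norm n vs = \<bar>minor vs I\<bar>"
proof -
  have "\<exists>I. I \<subseteq> {0..n} \<and> card I = length vs"
    using obtain_subset_with_card_n[of "length vs" "{0..n}"] assms by auto
  then have "wedge_norm n vs \<in> (\<lambda>I. \<bar>minor vs I\<bar>) ` {I. I \<subseteq> {0..n} \<and> card I = length vs}"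
    unfolding wedge_norm_minor using finite_card_subsets by (intro Max_in) auto
  then show ?thesis using that by auto
qed

lemma wedge_norm_nonneg: "length vs \<le> Suc n \<Longrightarrow> 0 \<le> wedge_norm n vs"
  by (metis wedge_norm_attained abs_ge_zero)

lemma minor_Nil [simp]: "minor [] I = 1"
  by (simp add: minor_def ldet_def)

lemma wedge_norm_Nil [simp]: "wedge_norm n [] = 1"
  by (rule wedge_norm_attained[of "[]" n]) auto

lemma nth_remove1_skip:
  assumes "distinct xs" "i < length xs" "a < length xs - 1"
  shows "remove1 (xs ! i) xs ! a = xs ! skip i a"
  using assms
proof (induction xs arbitrary: i a)
  case (Cons x xs)
  show ?case
  proof (cases i)
    case 0
    then show ?thesis by (simp add: skip_def)
  next
    case (Suc j)
    then have "x \<noteq> xs ! j" "j < length xs"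
      using Cons.prems by auto
    then show ?thesis
      using Cons Suc by (cases a) (auto simp: skip_def)
  qed
qed simp

lemma nth_sorted_list_of_set_remove:
  assumes "finite I" "i < card I" "a < card I - 1"
  shows "sorted_list_of_set (I - {sorted_list_of_set I ! i}) ! a = sorted_list_of_set I ! skip i a"
  using assms nth_remove1_skip[of "sorted_list_of_set I" i a]
  by (simp add: sorted_list_of_set_remove)

lemma nth_sorted_list_of_set_mem:
  "finite I \<Longrightarrow> i < card I \<Longrightarrow> sorted_list_of_set I ! i \<in> I"
  by (metis nth_mem length_sorted_list_of_set set_sorted_list_of_set)

lemma minor_Cons:
  assumes "finite I" "card I = Suc (length vs)"
  shows "minor (v # vs) I = (\<Sum>i<Suc (length vs). (- 1) ^ i * v (sorted_list_of_set I ! i) *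
           minor vs (I - {sorted_list_of_set I ! i}))"
proof -
  have "ldet (length vs) (\<lambda>a b. (vs ! b) (sorted_list_of_set I ! skip i a)) =
        minor vs (I - {sorted_list_of_set I ! i})" if "i < Suc (length vs)" for i
    unfolding minor_def using that assms
    by (intro ldet_cong) (simp add: nth_sorted_list_of_set_remove)
  then show ?thesis
    unfolding minor_def[of "v # vs"] by (simp add: ldet_laplace del: sum.lessThan_Suc)
qed

text \<open>Laplace expansion along the column \<open>v\<close> has at most n + 1 terms. Read
  backwards, it turns a lower bound for the wedge with \<open>v\<close> and an upper bound for the
  wedge without it into a lower bound for \<open>v\<close>.\<close>

lemma wedge_norm_Cons_le:
  assumes "length vs \<le> n"
  shows "wedge_norm n (v # vs) \<le> (real n + 1) * vnorm n v * wedge_norm n vs"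
proof -
  obtain I where I: "I \<subseteq> {0..n}" "card I = Suc (length vs)" "wedge_norm n (v # vs) = \<bar>minor (v # vs) I\<bar>"
    using wedge_norm_attained[of "v # vs" n] assms by auto
  have fin: "finite I"
    using I(1) finite_subset by blast
  let ?s = "\<lambda>i. sorted_list_of_set I ! i"
  have "\<bar>minor (v # vs) I\<bar> \<le> (\<Sum>i<Suc (length vs). \<bar>(- 1) ^ i * v (?s i) * minor vs (I - {?s i})\<bar>)"
    unfolding minor_Cons[OF fin I(2)] by (rule sum_abs)
  also have "\<dots> \<le> (\<Sum>i<Suc (length vs). vnorm n v * wedge_norm n vs)"
  proof (rule sum_mono)
    fix i assume "i \<in> {..<Suc (length vs)}"
    then have "?s i \<in> I"
      using nth_sorted_list_of_set_mem[OF fin] I(2) by simp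
    then have "\<bar>v (?s i)\<bar> \<le> vnorm n v" "\<bar>minor vs (I - {?s i})\<bar> \<le> wedge_norm n vs"
      using I(1,2) fin by (auto intro!: abs_le_vnorm abs_minor_le_wedge_norm simp: card_Diff_singleton)
    then show "\<bar>(- 1) ^ i * v (?s i) * minor vs (I - {?s i})\<bar> \<le> vnorm n v * wedge_norm n vs"
      by (simp add: abs_mult power_abs mult_mono vnorm_nonneg)
  qed
  also have "\<dots> = (real (length vs) + 1) * (vnorm n v * wedge_norm n vs)"
    by simp
  also have "\<dots> \<le> (real n + 1) * (vnorm n v * wedge_norm n vs)"
    using assms by (intro mult_right_mono mult_nonneg_nonneg vnorm_nonneg wedge_norm_nonneg) auto
  finally show ?thesis using I(3) by (simp add: mult.assoc)
qed

text \<open>On the rows in \<open>I\<close> the matrix of \<open>ws\<close> is that of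
  \<open>vs\<close> times \<open>c\<close>, so a change of vectors multiplies all coordinates of the
  wedge by one common determinant.\<close>

lemma minor_linear:
  assumes "length ws = length vs" "I \<subseteq> {0..n}" "card I = length vs"
    and "\<And>b i. b < length vs \<Longrightarrow> i \<le> n \<Longrightarrow> (ws ! b) i = (\<Sum>k<length vs. (vs ! k) i * c k b)"
  shows "minor ws I = minor vs I * ldet (length vs) c"
proof -
  have "sorted_list_of_set I ! a \<le> n" if "a < length vs" for a
    using nth_sorted_list_of_set_mem[of I a] assms(2,3) that finite_subset[OF assms(2)] by auto
  then show ?thesis
    unfolding minor_def assms(1) ldet_mult[symmetric]
    by (intro ldet_cong) (simp add: assms(4))
qed

lemma wedge_norm_linear:
  assumes "length ws = length vs"
    and "\<And>b i. b < length vs \<Longrightarrow> i \<le> n \<Longrightarrow> (ws ! b) i = (\<Sum>k<length vs. (vs ! k) i * c k b)"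
    and "length vs \<le> Suc n"
  shows "wedge_norm n ws = \<bar>ldet (length vs) c\<bar> * wedge_norm n vs"
proof (rule antisym)
  obtain I where I: "I \<subseteq> {0..n}" "card I = length vs" "wedge_norm n ws = \<bar>minor ws I\<bar>"
    using wedge_norm_attained[of ws n] assms by auto
  have "wedge_norm n ws = \<bar>ldet (length vs) c\<bar> * \<bar>minor vs I\<bar>"
    using I(3) minor_linear[OF assms(1) I(1,2) assms(2)] by (simp add: abs_mult)
  then show "wedge_norm n ws \<le> \<bar>ldet (length vs) c\<bar> * wedge_norm n vs"
    using I by (simp add: abs_minor_le_wedge_norm mult_left_mono)
  obtain I where I: "I \<subseteq> {0..n}" "card I = length vs" "wedge_norm n vs = \<bar>minor vs I\<bar>"
    using wedge_norm_attained[of vs n] assms by auto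
  have "\<bar>ldet (length vs) c\<bar> * wedge_norm n vs = \<bar>minor ws I\<bar>"
    using I(3) minor_linear[OF assms(1) I(1,2) assms(2)] by (simp add: abs_mult)
  then show "\<bar>ldet (length vs) c\<bar> * wedge_norm n vs \<le> wedge_norm n ws"
    using I assms(1) by (simp add: abs_minor_le_wedge_norm)
qed

definition add_mult :: "(nat \<Rightarrow> real) list \<Rightarrow> nat \<Rightarrow> nat \<Rightarrow> real \<Rightarrow> (nat \<Rightarrow> real) list" where
  "add_mult xs i j k = xs[i := (\<lambda>r. (xs ! i) r + k * (xs ! j) r)]"

lemma length_add_mult [simp]: "length (add_mult xs i j k) = length xs"
  by (simp add: add_mult_def)

lemma wedge_norm_add_mult:
  assumes "i < length xs" "j < length xs" "i \<noteq> j"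
  shows "wedge_norm n (add_mult xs i j k) = wedge_norm n xs"
proof -
  have "minor (add_mult xs i j k) I = minor xs I" for I
  proof -
    have "minor (add_mult xs i j k) I = ldet (length xs) (\<lambda>a b. if b = i
        then (xs ! i) (sorted_list_of_set I ! a) + k * (xs ! j) (sorted_list_of_set I ! a)
        else (xs ! b) (sorted_list_of_set I ! a))"
      unfolding minor_def length_add_mult
      by (rule ldet_cong) (use assms in \<open>auto simp: add_mult_def nth_list_update\<close>)
    then show ?thesis
      unfolding minor_def using ldet_addcol[OF assms] by simp
  qed
  then show ?thesis by (simp add: wedge_norm_minor)
qed

text \<open>The oblique projection along \<open>v\<close> onto the vectors with vanishing coordinate
  \<open>i0\<close>. With \<open>i0\<close> a coordinate where \<open>v\<close> is largest, it is
  the sup-norm substitute for the orthogonal projection in Hermite's reduction.\<close>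

definition proj :: "(nat \<Rightarrow> real) \<Rightarrow> nat \<Rightarrow> (nat \<Rightarrow> real) \<Rightarrow> nat \<Rightarrow> real" where
  "proj v i0 w = (\<lambda>i. w i - w i0 / v i0 * v i)"

text \<open>The projected vectors vanish at \<open>i0\<close>, so a nonzero minor of them avoids the
  row \<open>i0\<close>. Adding this row and the column \<open>v\<close> multiplies that minor by
  \<open>v i0\<close> up to sign, and undoing the projection is a unimodular column
  operation.\<close>

lemma wedge_norm_proj:
  assumes "v i0 \<noteq> 0" "i0 \<le> n" "length ws \<le> n"
  shows "\<bar>v i0\<bar> * wedge_norm n (map (proj v i0) ws) \<le> wedge_norm n (v # ws)"
proof -
  let ?ps = "map (proj v i0) ws"
  have p0: "w i0 = 0" if "w \<in> set ?ps" for w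
    using that assms(1) by (auto simp: proj_def)
  have zero: "minor ?ps I = 0" if I: "finite I" "card I = length ?ps" "i0 \<in> I" for I
  proof -
    obtain a where "a < card I" "sorted_list_of_set I ! a = i0"
      using I by (metis in_set_conv_nth length_sorted_list_of_set set_sorted_list_of_set)
    then show ?thesis
      unfolding minor_def using p0 I(2) by (intro ldet_zero_row[of a]) auto
  qed
  obtain I where I: "I \<subseteq> {0..n}" "card I = length ?ps" "wedge_norm n ?ps = \<bar>minor ?ps I\<bar>"
    using wedge_norm_attained[of ?ps n] assms(3) by auto
  have fin: "finite I"
    using I(1) finite_subset by blast
  show ?thesis
  proof (cases "i0 \<in> I")
    case True
    then show ?thesis
      using zero[OF fin I(2)] I(3) wedge_norm_nonneg[of "v # ws" n] assms(3) by simp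
  next
    case False
    define J where "J = insert i0 I"
    have J: "finite J" "card J = Suc (length ?ps)" "J \<subseteq> {0..n}"
      using False fin I assms(2) by (auto simp: J_def)
    let ?s = "\<lambda>i. sorted_list_of_set J ! i"
    have inj: "?s i = ?s j \<longleftrightarrow> i = j" if "i < Suc (length ?ps)" "j < Suc (length ?ps)" for i j
      using that J by (simp add: nth_eq_iff_index_eq)
    obtain m where m: "m < Suc (length ?ps)" "?s m = i0"
      using J by (metis J_def in_set_conv_nth insertI1 length_sorted_list_of_set set_sorted_list_of_set)
    have "minor (v # ?ps) J = (\<Sum>i<Suc (length ?ps). (- 1) ^ i * v (?s i) * minor ?ps (J - {?s i}))"
      using minor_Cons[OF J(1,2)] .
    \<comment> \<open>Deleting any row other than \<open>i0\<close> leaves the zero row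
      \<open>i0\<close> in the remaining minor.\<close>
    also have "\<dots> = (\<Sum>i<Suc (length ?ps). if i = m then (- 1) ^ m * v i0 * minor ?ps I else 0)"
    proof (rule sum.cong)
      fix i assume "i \<in> {..<Suc (length ?ps)}"
      then have i: "i < Suc (length ?ps)" by simp
      show "(- 1) ^ i * v (?s i) * minor ?ps (J - {?s i}) =
            (if i = m then (- 1) ^ m * v i0 * minor ?ps I else 0)"
      proof (cases "i = m")
        case True
        then show ?thesis using m False by (simp add: J_def)
      next
        case False
        then have "i0 \<in> J - {?s i}"
          using inj[OF i m(1)] m(2) by (auto simp: J_def)
        moreover have "card (J - {?s i}) = length ?ps"
          using nth_sorted_list_of_set_mem[OF J(1)] i J(1,2) by (simp add: card_Diff_singleton)
        ultimately show ?thesis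
          using zero[of "J - {?s i}"] J(1) False by simp
      qed
    qed simp
    also have "\<dots> = (- 1) ^ m * v i0 * minor ?ps I"
      using m(1) by (simp del: sum.lessThan_Suc)
    finally have 1: "\<bar>minor (v # ?ps) J\<bar> = \<bar>v i0\<bar> * wedge_norm n ?ps"
      using I(3) by (simp add: abs_mult power_abs)
    \<comment> \<open>Unit upper triangular: row 0 holds the multiples of \<open>v\<close> that the
      projection subtracts.\<close>
    define c :: "nat \<Rightarrow> nat \<Rightarrow> real" where
      "c k b = (if k = b then 1 else if k = 0 then - (ws ! (b - 1)) i0 / v i0 else 0)" for k b
    have "minor (v # ?ps) J = minor (v # ws) J * ldet (length (v # ws)) c"
    proof (rule minor_linear[where n = n])
      fix b i assume b: "b < length (v # ws)"
      have "(\<Sum>k<length (v # ws). ((v # ws) ! k) i * c k b) =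
            (\<Sum>k<length (v # ws). (if k = b then ((v # ws) ! b) i else 0) +
              (if k = 0 then (if b = 0 then 0 else - (ws ! (b - 1)) i0 / v i0 * v i) else 0))"
        by (rule sum.cong) (auto simp: c_def)
      also have "\<dots> = ((v # ws) ! b) i + (if b = 0 then 0 else - (ws ! (b - 1)) i0 / v i0 * v i)"
        using b by (simp add: sum.distrib del: sum.lessThan_Suc)
      finally show "((v # ?ps) ! b) i = (\<Sum>k<length (v # ws). ((v # ws) ! k) i * c k b)"
        using b by (cases b) (auto simp: proj_def)
    qed (use J in auto)
    also have "ldet (length (v # ws)) c = 1"
      by (subst ldet_upper_triangular) (auto simp: c_def)
    finally have "minor (v # ?ps) J = minor (v # ws) J"
      by simp
    then show ?thesis
      using 1 abs_minor_le_wedge_norm[of J n "v # ws"] J by simp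
  qed
qed

section \<open>Integer column operations and Hermite reduction in the sup norm\<close>

inductive zreach :: "(nat \<Rightarrow> real) list \<Rightarrow> (nat \<Rightarrow> real) list \<Rightarrow> bool" for xs where
  zreach_refl: "zreach xs xs"
| zreach_step: "zreach xs ys \<Longrightarrow> i < length ys \<Longrightarrow> j < length ys \<Longrightarrow> i \<noteq> j \<Longrightarrow>
    zreach xs (add_mult ys i j (of_int k))"

lemma zreach_length: "zreach xs ys \<Longrightarrow> length ys = length xs"
  by (induction rule: zreach.induct) auto

lemma zreach_wedge_norm: "zreach xs ys \<Longrightarrow> wedge_norm n ys = wedge_norm n xs"
  by (induction rule: zreach.induct) (auto simp: wedge_norm_add_mult)

lemma zreach_trans:
  assumes "zreach ys zs" "zreach xs ys"
  shows "zreach xs zs"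
  using assms by (induction rule: zreach.induct) (auto intro: zreach_step)

lemma zreach_Cons: "zreach xs ys \<Longrightarrow> zreach (x # xs) (x # ys)"
proof (induction rule: zreach.induct)
  case (zreach_step ys i j k)
  then have "zreach (x # xs) (add_mult (x # ys) (Suc i) (Suc j) (of_int k))"
    by (intro zreach.zreach_step) auto
  then show ?case by (simp add: add_mult_def)
qed (rule zreach_refl)

text \<open>An operation is described by two positions and an integer only, so it can be replayed on
  the preimages. This lifts bases of the projected lattice.\<close>

lemma zreach_map:
  assumes "zreach (map F xs) ys"
    and lin: "\<And>x y k. F (\<lambda>r. x r + k * y r) = (\<lambda>r. F x r + k * F y r)"
  shows "\<exists>zs. zreach xs zs \<and> ys = map F zs"
  using assms(1)
proof (induction rule: zreach.induct)
  case (zreach_step ys i j k)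
  then obtain zs where zs: "zreach xs zs" "ys = map F zs" by blast
  then have "zreach xs (add_mult zs i j (of_int k))"
    using zreach_step by (intro zreach.zreach_step) auto
  moreover have "add_mult ys i j (of_int k) = map F (add_mult zs i j (of_int k))"
    using zreach_step zs(2) by (simp add: add_mult_def map_update lin)
  ultimately show ?case by blast
qed (auto intro: zreach_refl)

text \<open>There is no exchange among the elementary operations. Three additions replace it: (a,
  b), (a + b, b), (a + b, -a), (b, -a) exchanges two vectors up to a sign.\<close>

lemma zreach_swap_sub:
  "\<exists>ws. zreach (v # w # zs) ((\<lambda>r. w r - of_int k * v r) # ws)"
proof -
  define w' where "w' = (\<lambda>r. w r - of_int k * v r)"
  have 1: "add_mult (v # w # zs) 1 0 (of_int (- k)) = v # w' # zs"
    by (simp add: add_mult_def w'_def)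
  have 2: "add_mult (v # w' # zs) 0 1 (of_int 1) = (\<lambda>r. v r + w' r) # w' # zs"
    by (simp add: add_mult_def)
  have 3: "add_mult ((\<lambda>r. v r + w' r) # w' # zs) 1 0 (of_int (-1)) =
           (\<lambda>r. v r + w' r) # (\<lambda>r. - v r) # zs"
    by (simp add: add_mult_def)
  have 4: "add_mult ((\<lambda>r. v r + w' r) # (\<lambda>r. - v r) # zs) 0 1 (of_int 1) = w' # (\<lambda>r. - v r) # zs"
    by (simp add: add_mult_def)
  let ?L = "v # w # zs"
  have "zreach ?L (v # w' # zs)"
    unfolding 1[symmetric] by (intro zreach_step zreach_refl) auto
  then have "zreach ?L ((\<lambda>r. v r + w' r) # w' # zs)"
    unfolding 2[symmetric] by (intro zreach_step) auto
  then have "zreach ?L ((\<lambda>r. v r + w' r) # (\<lambda>r. - v r) # zs)"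
    unfolding 3[symmetric] by (intro zreach_step) auto
  then have "zreach ?L (w' # (\<lambda>r. - v r) # zs)"
    unfolding 4[symmetric] by (intro zreach_step) auto
  then show ?thesis unfolding w'_def by blast
qed

text \<open>Hermite's argument for the sup norm: project along an almost shortest vector that starts a
  basis; a vector of the projected lattice lifts, after subtracting a multiple of the projected
  direction, to one that is longer by at most half of that shortest length.\<close>

lemma wedge_norm_ge_shortest:
  assumes "0 < \<delta>" "length xs \<le> Suc n"
    and "\<And>y ys. zreach xs (y # ys) \<Longrightarrow> \<delta> \<le> vnorm n y"
  shows "(9/20) ^ (length xs * length xs) * \<delta> ^ length xs \<le> wedge_norm n xs"
  using assms
proof (induction "length xs" arbitrary: xs \<delta>)
  case 0
  then show ?case by simp
next
  case (Suc k)
  define R where "R = {vnorm n y | y ys. zreach xs (y # ys)}"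
  define m0 where "m0 = Inf R"
  have ne: "R \<noteq> {}"
    using Suc.hyps(2) zreach_refl[of xs] unfolding R_def by (cases xs) auto
  have lb: "\<delta> \<le> r" if "r \<in> R" for r
    using that Suc.prems(3) by (auto simp: R_def)
  have m0: "\<delta> \<le> m0"
    unfolding m0_def using ne lb by (intro cInf_greatest) auto
  have m0_le: "m0 \<le> vnorm n y" if "zreach xs (y # ys)" for y ys
    unfolding m0_def using that lb by (intro cInf_lower) (auto simp: R_def intro!: bdd_belowI)
  \<comment> \<open>The infimum need not be attained. With a vector shorter than 11/10 of it,
    rounding costs at most half of that length, and 1 - 11/20 = 9/20 is the constant of the
    induction.\<close>
  have "m0 < 11/10 * m0"
    using m0 Suc.prems(1) by simp
  then obtain y0 ys where y0: "zreach xs (y0 # ys)" "vnorm n y0 < 11/10 * m0"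
    using cInf_lessD[OF ne, folded m0_def] unfolding R_def by blast
  obtain i0 where i0: "i0 \<le> n" "vnorm n y0 = \<bar>y0 i0\<bar>"
    using vnorm_attained by blast
  have len: "length ys = k"
    using zreach_length[OF y0(1)] Suc.hyps(2) by simp
  have m: "m0 \<le> \<bar>y0 i0\<bar>" "\<bar>y0 i0\<bar> < 11/10 * m0"
    using m0_le[OF y0(1)] y0(2) i0(2) by auto
  have "y0 i0 \<noteq> 0"
    using m(1) m0 Suc.prems(1) by auto
  let ?p = "proj y0 i0"
  have "(9/20) ^ (length (map ?p ys) * length (map ?p ys)) * (9/20 * m0) ^ length (map ?p ys)
        \<le> wedge_norm n (map ?p ys)"
  proof (rule Suc.hyps(1))
    show "0 < 9/20 * m0"
      using m0 Suc.prems(1) by simp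
    show "length (map ?p ys) \<le> Suc n"
      using len Suc.hyps(2) Suc.prems(2) by simp
    fix z zs assume "zreach (map ?p ys) (z # zs)"
    then have "\<exists>us. zreach ys us \<and> z # zs = map ?p us"
      by (rule zreach_map) (simp add: proj_def fun_eq_iff algebra_simps add_divide_distrib)
    then obtain w ws where w: "zreach ys (w # ws)" "z = ?p w"
      by (auto simp: Cons_eq_map_conv)
    define q where "q = w i0 / y0 i0"
    obtain us where "zreach (y0 # w # ws) ((\<lambda>r. w r - of_int (round q) * y0 r) # us)"
      using zreach_swap_sub by blast
    then have "zreach xs ((\<lambda>r. w r - of_int (round q) * y0 r) # us)"
      using zreach_trans zreach_Cons[OF w(1)] y0(1) by blast
    then have "m0 \<le> vnorm n (\<lambda>r. w r - of_int (round q) * y0 r)"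
      by (rule m0_le)
    also have "\<dots> \<le> vnorm n z + 1/2 * \<bar>y0 i0\<bar>"
    proof (rule vnorm_leI)
      fix i assume i: "i \<le> n"
      have "w i - of_int (round q) * y0 i = z i + (q - of_int (round q)) * y0 i"
        unfolding w(2) proj_def q_def by (simp add: algebra_simps)
      also have "\<bar>\<dots>\<bar> \<le> \<bar>z i\<bar> + \<bar>q - of_int (round q)\<bar> * \<bar>y0 i\<bar>"
        using abs_triangle_ineq[of "z i" "(q - of_int (round q)) * y0 i"] by (simp only: abs_mult)
      also have "\<dots> \<le> vnorm n z + 1/2 * \<bar>y0 i0\<bar>"
      proof (intro add_mono mult_mono)
        show "\<bar>q - of_int (round q)\<bar> \<le> 1/2"
          using of_int_round_abs_le[of q] by (simp add: abs_minus_commute)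
        show "\<bar>y0 i\<bar> \<le> \<bar>y0 i0\<bar>"
          using abs_le_vnorm[OF i, of y0] i0(2) by simp
      qed (auto simp: abs_le_vnorm i)
      finally show "\<bar>w i - of_int (round q) * y0 i\<bar> \<le> vnorm n z + 1/2 * \<bar>y0 i0\<bar>" .
    qed
    finally show "9/20 * m0 \<le> vnorm n z"
      using m(2) by linarith
  qed (simp add: len)
  then have IH: "(9/20) ^ (k * k) * (9/20 * m0) ^ k \<le> wedge_norm n (map ?p ys)"
    using len by simp
  \<comment> \<open>The exponent k * k comes from the induction hypothesis, and k more from the
    factor 9/20 in each of the k projected lengths.\<close>
  have "(9/20) ^ (Suc k * Suc k) * \<delta> ^ Suc k \<le> (9/20) ^ (k * k + k) * \<delta> ^ Suc k"
    using Suc.prems(1) by (intro mult_right_mono power_decreasing) auto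
  also have "\<dots> = \<delta> * ((9/20) ^ (k * k) * (9/20 * \<delta>) ^ k)"
    by (simp only: power_add power_mult_distrib power_Suc mult_ac)
  also have "\<dots> \<le> \<bar>y0 i0\<bar> * ((9/20) ^ (k * k) * (9/20 * m0) ^ k)"
    using m m0 Suc.prems(1) by (intro mult_mono power_mono) auto
  also have "\<dots> \<le> \<bar>y0 i0\<bar> * wedge_norm n (map ?p ys)"
    using IH by (intro mult_left_mono) auto
  also have "\<dots> \<le> wedge_norm n (y0 # ys)"
    using wedge_norm_proj[of y0 i0 n ys] \<open>y0 i0 \<noteq> 0\<close> i0(1) len Suc.hyps(2) Suc.prems(2) by simp
  also have "\<dots> = wedge_norm n xs"
    by (rule zreach_wedge_norm[OF y0(1)])
  finally show ?case
    using Suc.hyps(2) by simp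
qed

section \<open>Covolumes under the flow, bounded below by the shortest vector\<close>

definition rvec :: "(nat \<Rightarrow> int) \<Rightarrow> nat \<Rightarrow> real" where
  "rvec v = (\<lambda>i. of_int (v i))"

lemma gu_norm_rvec: "gu_norm n t y vs = wedge_norm n (map (\<lambda>v. gu_act n t y (rvec v)) vs)"
  by (simp add: gu_norm_def rvec_def)

lemma gu_act_linear:
  "gu_act n t y (\<lambda>r. v r + k * w r) = (\<lambda>r. gu_act n t y v r + k * gu_act n t y w r)"
proof -
  have "(\<Sum>j=1..n. y j * (v j + k * w j)) = (\<Sum>j=1..n. y j * v j) + k * (\<Sum>j=1..n. y j * w j)"
    by (simp add: algebra_simps sum.distrib sum_distrib_left)
  then show ?thesis
    by (auto simp: gu_act_def fun_eq_iff algebra_simps)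
qed

lemma S_basis_update:
  assumes "S_basis n ws" "i < length ws" "j < length ws" "i \<noteq> j"
  shows "S_basis n (ws[i := (\<lambda>r. (ws ! i) r + k * (ws ! j) r)])" (is "S_basis n ?us")
proof -
  have "\<forall>v\<in>set ?us. \<forall>r>n. v r = 0"
  proof (intro ballI allI impI)
    fix v r assume v: "v \<in> set ?us" and r: "n < r"
    have "\<forall>w\<in>set ws. w r = 0"
      using assms(1) r by (simp add: S_basis_def)
    then have "(ws ! i) r = 0" "(ws ! j) r = 0"
      using assms(2,3) by simp_all
    moreover have "v = (\<lambda>r. (ws ! i) r + k * (ws ! j) r) \<or> v \<in> set ws"
      using subsetD[OF set_update_subset_insert v] by simp
    ultimately show "v r = 0"
      using \<open>\<forall>w\<in>set ws. w r = 0\<close> by auto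
  qed
  moreover have "\<forall>l<length ws. c l = 0"
    if c: "\<forall>r. (\<Sum>l<length ws. c l * real_of_int ((?us ! l) r)) = 0" for c
  proof -
    \<comment> \<open>A relation among the new vectors, rewritten in the old ones: the change of
      entry \<open>i\<close> moves \<open>c i * k\<close> into the coefficient of entry
      \<open>j\<close>.\<close>
    define d where "d l = (if l = j then c j + c i * of_int k else c l)" for l
    have "(\<Sum>l<length ws. d l * of_int ((ws ! l) r)) = 0" for r
    proof -
      have "(\<Sum>l<length ws. d l * of_int ((ws ! l) r)) =
         (\<Sum>l<length ws. c l * of_int ((ws ! l) r) + (if l = j then c i * of_int k * of_int ((ws ! j) r) else 0))"
        by (rule sum.cong) (auto simp: d_def algebra_simps)
      also have "\<dots> = (\<Sum>l<length ws. c l * of_int ((ws ! l) r) + (if l = i then c i * of_int k * of_int ((ws ! j) r) else 0))"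
        using assms(2,3) by (simp add: sum.distrib)
      also have "\<dots> = (\<Sum>l<length ws. c l * real_of_int ((?us ! l) r))"
        using assms(2) by (intro sum.cong) (auto simp: nth_list_update algebra_simps)
      finally show ?thesis using c by simp
    qed
    then have d0: "\<forall>l<length ws. d l = 0"
      using assms(1) unfolding S_basis_def by blast
    then have "c l = 0" if "l < length ws" "l \<noteq> j" for l
      using that by (auto simp: d_def)
    moreover from this have "c j = 0"
      using d0 assms by (auto simp: d_def)
    ultimately show ?thesis by blast
  qed
  ultimately show ?thesis
    using assms(1) unfolding S_basis_def by simp
qed

lemma S_basis_nonzero:
  assumes "S_basis n ws" "v \<in> set ws"
  shows "v \<noteq> (\<lambda>_. 0)"
proof
  assume v0: "v = (\<lambda>_. 0)"
  obtain b where b: "b < length ws" "ws ! b = v"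
    using assms(2) by (auto simp: in_set_conv_nth)
  have "(\<Sum>k<length ws. (if k = b then 1 else 0) * real_of_int ((ws ! k) i)) = 0" for i
    using b v0 by (intro sum.neutral) auto
  moreover have "(\<forall>i. (\<Sum>k<length ws. c k * of_int ((ws ! k) i)) = 0) \<longrightarrow> (\<forall>k<length ws. c k = 0)"
    for c :: "nat \<Rightarrow> real"
    using assms(1) unfolding S_basis_def by blast
  from this[of "\<lambda>k. if k = b then 1 else 0"] calculation
  have "\<forall>k<length ws. (if k = b then 1 else 0) = (0::real)"
    by simp
  then show False using b(1) by auto
qed

text \<open>The action is linear, so each integer operation on the images comes from one on the
  integer basis. Every vector heading a reachable list is thus the image of a nonzero integer
  vector, as Hermite's bound requires.\<close>

lemma gu_norm_ge_shortest:
  assumes "S_basis n vs" "0 < \<delta>"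
    and short: "\<And>v. \<forall>i>n. v i = 0 \<Longrightarrow> v \<noteq> (\<lambda>_. 0) \<Longrightarrow> \<delta> \<le> vnorm n (gu_act n t y (rvec v))"
  shows "(9/20) ^ (length vs * length vs) * \<delta> ^ length vs \<le> gu_norm n t y vs"
proof -
  let ?h = "\<lambda>v. gu_act n t y (rvec v)"
  have reach: "\<exists>ws. S_basis n ws \<and> ys = map ?h ws" if "zreach (map ?h vs) ys" for ys
    using that
  proof (induction rule: zreach.induct)
    case (zreach_step ys i j k)
    then obtain ws where ws: "S_basis n ws" "ys = map ?h ws" by blast
    let ?us = "ws[i := (\<lambda>r. (ws ! i) r + k * (ws ! j) r)]"
    have "rvec (\<lambda>r. (ws ! i) r + k * (ws ! j) r) = (\<lambda>r. rvec (ws ! i) r + of_int k * rvec (ws ! j) r)"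
      by (simp add: rvec_def)
    then have "add_mult ys i j (of_int k) = map ?h ?us"
      using zreach_step ws by (simp add: add_mult_def map_update gu_act_linear)
    moreover have "S_basis n ?us"
      using zreach_step.hyps ws by (intro S_basis_update) simp_all
    ultimately show ?case by blast
  qed (use assms(1) in blast)
  have len: "length vs \<le> n"
    using assms(1) by (simp add: S_basis_def)
  have "(9/20) ^ (length (map ?h vs) * length (map ?h vs)) * \<delta> ^ length (map ?h vs)
        \<le> wedge_norm n (map ?h vs)"
  proof (rule wedge_norm_ge_shortest)
    fix z zs assume "zreach (map ?h vs) (z # zs)"
    from reach[OF this] obtain ws where ws: "S_basis n ws" "z # zs = map ?h ws"
      by (elim exE conjE)
    from ws(2) obtain w ws' where w: "ws = w # ws'" "z = ?h w"
      by (cases ws) simp_all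
    have "w \<in> set ws"
      using w(1) by simp
    moreover have "\<forall>v\<in>set ws. \<forall>i>n. v i = 0"
      using ws(1) by (simp add: S_basis_def)
    ultimately have "\<forall>i>n. w i = 0" "w \<noteq> (\<lambda>_. 0)"
      using S_basis_nonzero[OF ws(1)] by blast+
    then show "\<delta> \<le> vnorm n z"
      using short w(2) by simp
  next
    show "length (map ?h vs) \<le> Suc n"
      using len by simp
  qed (fact assms(2))
  then show ?thesis by (simp add: gu_norm_rvec)
qed

section \<open>Nondivergence for a family of good functions\<close>

text \<open>Goodness with the supremum replaced by the value at each point of the ball. This avoids
  infinite suprema, passes to maxima of finitely many functions, and suffices because the argument
  always has a point where the function is at least \<rho>.\<close>

definition pgood :: "real \<Rightarrow> real \<Rightarrow> 'a::euclidean_space set \<Rightarrow> ('a \<Rightarrow> real) \<Rightarrow> bool" where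
  "pgood C \<alpha> V h \<longleftrightarrow>
     (\<forall>z r. 0 < r \<longrightarrow> ball z r \<subseteq> V \<longrightarrow> (\<forall>\<epsilon>>0. \<forall>y\<in>ball z r.
       measure lebesgue {x \<in> ball z r. \<bar>h x\<bar> < \<epsilon> * \<bar>h y\<bar>} \<le> C * \<epsilon> powr \<alpha> * measure lebesgue (ball z r)))"

lemma measure_ball_scale:
  fixes x y :: "'a::euclidean_space"
  assumes "0 \<le> c" "0 \<le> r"
  shows "measure lebesgue (ball x (c * r)) = c ^ DIM('a) * measure lebesgue (ball y r)"
  using content_ball_conv_unit_ball[of r y] content_ball_conv_unit_ball[of "c * r" x] assms
  by (simp add: power_mult_distrib)

lemma measure_ball_pos: "0 < r \<Longrightarrow> 0 < measure lebesgue (ball (x::'a::euclidean_space) r)"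
  using content_ball_pos[of r x] by simp

lemma open_sublevel:
  fixes h :: "'a::euclidean_space \<Rightarrow> real"
  assumes "open V" "continuous_on V h" "ball z r \<subseteq> V"
  shows "open {x \<in> ball z r. h x < a}"
proof -
  have "open (ball z r \<inter> h -` {..<a})"
    using assms by (intro continuous_open_preimage continuous_on_subset[OF assms(2)]) auto
  moreover have "ball z r \<inter> h -` {..<a} = {x \<in> ball z r. h x < a}"
    by auto
  ultimately show ?thesis by simp
qed

lemma lmeasurable_sublevel:
  fixes h :: "'a::euclidean_space \<Rightarrow> real"
  assumes "open V" "continuous_on V h" "ball z r \<subseteq> V"
  shows "{x \<in> ball z r. h x < a} \<in> lmeasurable"
  by (intro lmeasurable_open open_sublevel[OF assms] bounded_subset[OF bounded_ball[of z r]]) auto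

text \<open>The factor 30 is 10 times 3: the exceptional sets live on tenfold enlargements of
  disjoint balls, and those disjoint balls lie in a threefold enlargement of the original one. The
  value 0 belongs to a full flag, for which every point is marked.\<close>

fun nd_const :: "real \<Rightarrow> nat \<Rightarrow> nat \<Rightarrow> real" where
  "nd_const C d 0 = 0"
| "nd_const C d (Suc m) = (nd_const C d m + C) * 30 ^ d"

lemma nd_const_nonneg: "0 \<le> C \<Longrightarrow> 0 \<le> nd_const C d m"
  by (induction m) auto

text \<open>In the application \<open>P\<close> consists of the bases, \<open>rk\<close> is the
  length, \<open>le\<close> is inclusion of real spans and \<open>\<psi> s x\<close> is the covolume
  at \<open>f x\<close>. The second condition on \<open>K\<close> is what controls a function on a
  tenfold larger ball.\<close>

locale nondivergence =
  fixes V :: "'a::euclidean_space set" and C \<alpha> K :: real and n :: nat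
    and P :: "'s set" and rk :: "'s \<Rightarrow> nat" and le :: "'s \<Rightarrow> 's \<Rightarrow> bool"
    and \<psi> :: "'s \<Rightarrow> 'a \<Rightarrow> real"
  assumes open_V: "open V" and C_pos: "0 < C"
    and K: "1 \<le> K" "C * (1 / K) powr \<alpha> * 10 ^ DIM('a) < 1"
    and cont: "s \<in> P \<Longrightarrow> continuous_on V (\<psi> s)"
    and nonneg: "s \<in> P \<Longrightarrow> 0 \<le> \<psi> s x"
    and good: "s \<in> P \<Longrightarrow> pgood C \<alpha> V (\<psi> s)"
    and rk_range: "s \<in> P \<Longrightarrow> rk s \<in> {1..n}"
    and le_trans: "s \<in> P \<Longrightarrow> u \<in> P \<Longrightarrow> w \<in> P \<Longrightarrow> le s u \<Longrightarrow> le u w \<Longrightarrow> le s w"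
    and le_sym: "s \<in> P \<Longrightarrow> u \<in> P \<Longrightarrow> rk s = rk u \<Longrightarrow> le s u \<Longrightarrow> le u s"
    and proportional: "s \<in> P \<Longrightarrow> u \<in> P \<Longrightarrow> rk s = rk u \<Longrightarrow> le s u \<Longrightarrow> \<exists>c. \<forall>x. \<psi> s x = c * \<psi> u x"
begin

text \<open>Comparability is strict in the rank. So the members of a flag have distinct ranks, and
  an element comparable to all of them is not a member itself.\<close>

definition cmp :: "'s \<Rightarrow> 's \<Rightarrow> bool" where
  "cmp s u \<longleftrightarrow> (rk s < rk u \<and> le s u) \<or> (rk u < rk s \<and> le u s)"

definition ext :: "'s set \<Rightarrow> 's set" where
  "ext F = {s \<in> P. \<forall>u\<in>F. cmp s u}"

definition flag :: "'s set \<Rightarrow> bool" where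
  "flag F \<longleftrightarrow> F \<subseteq> P \<and> (\<forall>s\<in>F. \<forall>u\<in>F. s \<noteq> u \<longrightarrow> cmp s u)"

text \<open>Elements of \<open>P\<close> stand for bases, so several of them may have the same span; the last condition
  in \<open>marked\<close> bounds \<open>\<psi>\<close> from below for all of them, which replaces the usual restriction to
  primitive subgroups.\<close>

definition marked :: "'s set \<Rightarrow> real \<Rightarrow> real \<Rightarrow> 'a \<Rightarrow> bool" where
  "marked F \<rho> \<epsilon> x \<longleftrightarrow> (\<exists>G. F \<subseteq> G \<and> flag G \<and> (\<forall>s\<in>ext G. \<rho> \<le> \<psi> s x) \<and>
     (\<forall>s\<in>G - F. \<psi> s x \<le> K * \<rho> \<and> (\<forall>u\<in>P. rk u = rk s \<longrightarrow> le u s \<longrightarrow> \<epsilon> * \<rho> / K \<le> \<psi> u x)))"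

lemma flag_insert: "flag F \<Longrightarrow> s \<in> ext F \<Longrightarrow> flag (insert s F)"
  unfolding flag_def ext_def by (auto simp: cmp_def)

lemma ext_insert_subset: "ext (insert s F) \<subseteq> ext F"
  by (auto simp: ext_def)

text \<open>Comparability depends only on rank and span: equal rank makes \<open>le\<close>
  symmetric, and transitivity carries each comparison over from \<open>s\<close> to
  \<open>u\<close>.\<close>

lemma ext_same_span:
  assumes "flag F" "s \<in> ext F" "u \<in> P" "rk u = rk s" "le u s"
  shows "u \<in> ext F"
proof -
  have s: "s \<in> P"
    using assms(2) by (simp add: ext_def)
  have su: "le s u"
    using le_sym[OF assms(3) s] assms(4,5) by simp
  have "cmp u w" if "w \<in> F" for w
  proof -
    have "w \<in> P" "cmp s w"
      using that assms(1,2) by (auto simp: flag_def ext_def)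
    then show ?thesis
      using assms(3-5) s su le_trans unfolding cmp_def by metis
  qed
  then show ?thesis
    using assms(3) by (simp add: ext_def)
qed

text \<open>If the value at \<open>y\<close> exceeded K \<rho>, the whole small ball would lie in
  the sublevel set at 1/K of that value in the tenfold ball. By the choice of \<open>K\<close>,
  goodness makes this set smaller than the small ball.\<close>

lemma doubling:
  assumes "s \<in> P" "0 < q" "ball x (10 * q) \<subseteq> V" "\<forall>y\<in>ball x q. \<psi> s y < \<rho>" "y \<in> ball x (10 * q)"
  shows "\<psi> s y \<le> K * \<rho>"
proof (rule ccontr)
  assume "\<not> ?thesis"
  then have y: "\<rho> < 1 / K * \<psi> s y"
    using K(1) by (simp add: field_simps)
  have abs [simp]: "\<bar>\<psi> s z\<bar> = \<psi> s z" for z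
    using nonneg[OF assms(1)] by simp
  let ?S = "{z \<in> ball x (10 * q). \<psi> s z < 1 / K * \<psi> s y}"
  have pos: "0 < 10 * q" "0 < 1 / K"
    using assms(2) K(1) by auto
  have "measure lebesgue (ball x q) \<le> measure lebesgue ?S"
  proof (rule measure_mono_fmeasurable)
    show "ball x q \<subseteq> ?S"
      using assms(2,4) y by fastforce
    show "?S \<in> lmeasurable"
      by (rule lmeasurable_sublevel[OF open_V cont[OF assms(1)] assms(3)])
  qed auto
  also have "\<dots> \<le> C * (1 / K) powr \<alpha> * measure lebesgue (ball x (10 * q))"
    using good[OF assms(1)] pos assms(3,5) unfolding pgood_def abs by blast
  also have "\<dots> = C * (1 / K) powr \<alpha> * 10 ^ DIM('a) * measure lebesgue (ball x q)"
    using measure_ball_scale[of 10 q x x] assms(2) by simp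
  also have "\<dots> < 1 * measure lebesgue (ball x q)"
    using K(2) measure_ball_pos[OF assms(2)] by (intro mult_strict_right_mono) auto
  finally show False by simp
qed

text \<open>The radius is within a factor 2 of the supremum of all radii for which some element of
  \<open>ext F\<close> stays below \<open>\<rho>\<close>, so no discreteness of \<open>P\<close> is needed to find it.\<close>

lemma almost_maximal_ball:
  assumes "ball z r \<subseteq> V" "x \<in> ball z r" "s0 \<in> ext F" "\<psi> s0 x < \<rho>"
    and large: "\<forall>u\<in>ext F. \<exists>y\<in>ball z r. \<rho> \<le> \<psi> u y"
  shows "\<exists>s q. s \<in> ext F \<and> 0 < q \<and> q < 2 * r \<and> (\<forall>y\<in>ball x q. \<psi> s y < \<rho>) \<and>
           (\<forall>u\<in>ext F. \<exists>y\<in>ball x (2 * q). \<rho> \<le> \<psi> u y)"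
proof -
  define R where "R = {q. 0 < q \<and> (\<exists>s\<in>ext F. \<forall>y\<in>ball x q. \<psi> s y < \<rho>)}"
  have s0: "s0 \<in> P"
    using assms(3) by (simp add: ext_def)
  have "open {y \<in> ball z r. \<psi> s0 y < \<rho>}" "x \<in> {y \<in> ball z r. \<psi> s0 y < \<rho>}"
    using open_sublevel[OF open_V cont[OF s0] assms(1)] assms(2,4) by auto
  then obtain e where "0 < e" "ball x e \<subseteq> {y \<in> ball z r. \<psi> s0 y < \<rho>}"
    by (meson open_contains_ball)
  then have ne: "e \<in> R"
    using assms(3) by (auto simp: R_def)
  \<comment> \<open>A ball of radius 2r around a point of \<open>ball z r\<close> contains
    \<open>ball z r\<close>, where every element of \<open>ext F\<close> reaches \<rho>.\<close>
  have bound: "q < 2 * r" if "q \<in> R" for q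
  proof (rule ccontr)
    assume q: "\<not> q < 2 * r"
    have "ball z r \<subseteq> ball x q"
    proof
      fix w assume "w \<in> ball z r"
      then show "w \<in> ball x q"
        using assms(2) q dist_triangle[of x w z] by (simp add: dist_commute)
    qed
    then show False
      using that large by (fastforce simp: R_def)
  qed
  have bdd: "bdd_above R"
    using bound by (intro bdd_aboveI[of _ "2 * r"]) (auto intro: less_imp_le)
  have "0 < Sup R"
    using cSup_upper[OF ne bdd] ne by (auto simp: R_def)
  then have "Sup R / 2 < Sup R" by simp
  then obtain q where q: "q \<in> R" "Sup R / 2 < q"
    using less_cSupD ne by (metis empty_iff)
  have "2 * q \<notin> R"
    using cSup_upper[OF _ bdd, of "2 * q"] q(2) by auto
  moreover have "0 < 2 * q"
    using q(1) by (simp add: R_def)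
  ultimately have "\<forall>u\<in>ext F. \<exists>y\<in>ball x (2 * q). \<rho> \<le> \<psi> u y"
    unfolding R_def by (auto simp: not_less)
  then show ?thesis
    using q(1) bound[OF q(1)] unfolding R_def by blast
qed

text \<open>The same flag \<open>G\<close> serves for \<open>F\<close>; only the conditions at
  \<open>s\<close> are new. An element \<open>u\<close> with the span of \<open>s\<close> has \<psi>
  u = c \<psi> s. Since \<psi> u reaches \<rho> somewhere on \<open>B\<close>, where \<psi> s stays
  below K \<rho>, the factor c is at least 1/K. This is the origin of the division by
  \<open>K\<close> in \<open>marked\<close>.\<close>

lemma marked_insert:
  assumes F: "flag F" "s \<in> ext F" and m: "marked (insert s F) \<rho> \<epsilon> x" and "0 < \<rho>"
    and up: "\<And>y. y \<in> B \<Longrightarrow> \<psi> s y \<le> K * \<rho>" "x \<in> B"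
    and large: "\<forall>u\<in>ext F. \<exists>y\<in>B. \<rho> \<le> \<psi> u y" and low: "\<epsilon> * \<rho> \<le> \<psi> s x"
  shows "marked F \<rho> \<epsilon> x"
proof -
  obtain G where G: "insert s F \<subseteq> G" "flag G" "\<forall>s\<in>ext G. \<rho> \<le> \<psi> s x"
    "\<forall>w\<in>G - insert s F. \<psi> w x \<le> K * \<rho> \<and> (\<forall>u\<in>P. rk u = rk w \<longrightarrow> le u w \<longrightarrow> \<epsilon> * \<rho> / K \<le> \<psi> u x)"
    using m unfolding marked_def by blast
  have s: "s \<in> P"
    using F(2) by (simp add: ext_def)
  have "\<epsilon> * \<rho> / K \<le> \<psi> u x" if u: "u \<in> P" "rk u = rk s" "le u s" for u
  proof -
    obtain c where c: "\<And>x. \<psi> u x = c * \<psi> s x"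
      using proportional[OF u(1) s u(2,3)] by blast
    obtain y where y: "y \<in> B" "\<rho> \<le> \<psi> u y"
      using large ext_same_span[OF F u] by blast
    have "0 < c"
      using y(2) c[of y] nonneg[OF s, of y] assms(4)
      by (metis less_le_trans mult_nonpos_nonneg not_less)
    then have "\<rho> \<le> c * (K * \<rho>)"
      using y c[of y] up(1)[OF y(1)] by (metis mult_left_mono order_trans less_imp_le)
    then have "1 / K \<le> c"
      using assms(4) K(1) by (simp add: field_simps)
    moreover have "0 \<le> \<psi> s x"
      by (rule nonneg[OF s])
    ultimately have "1 / K * \<psi> s x \<le> \<psi> u x"
      unfolding c by (rule mult_right_mono)
    moreover have "\<epsilon> * \<rho> / K \<le> 1 / K * \<psi> s x"
      using low K(1) by (simp add: divide_right_mono)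
    ultimately show ?thesis by linarith
  qed
  then have "\<forall>w\<in>G - F. \<psi> w x \<le> K * \<rho> \<and> (\<forall>u\<in>P. rk u = rk w \<longrightarrow> le u w \<longrightarrow> \<epsilon> * \<rho> / K \<le> \<psi> u x)"
    using G(4) up by blast
  then show ?thesis
    unfolding marked_def using G(1-3) by (intro exI[of _ G]) blast
qed

text \<open>The n distinct ranks of the members fill {1..n}, so no rank is left for another
  comparable element.\<close>

lemma flag_full_ext:
  assumes "flag F" "finite F" "card F = n"
  shows "ext F = {}"
proof -
  have "inj_on rk F"
    using assms(1) unfolding flag_def cmp_def inj_on_def by (metis less_irrefl)
  then have "card (rk ` F) = n"
    using assms(3) by (simp add: card_image)
  moreover have "rk ` F \<subseteq> {1..n}"
    using assms(1) rk_range by (auto simp: flag_def)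
  ultimately have "rk ` F = {1..n}"
    by (intro card_subset_eq) simp_all
  have False if "s \<in> ext F" for s
  proof -
    have "rk s \<in> rk ` F"
      using that rk_range \<open>rk ` F = {1..n}\<close> by (simp add: ext_def)
    then obtain u where "u \<in> F" "rk u = rk s" by auto
    then show False
      using that by (auto simp: ext_def cmp_def)
  qed
  then show ?thesis by blast
qed

text \<open>Induction on the number m of members that the flag lacks. Around a point where some
  extension is below \<rho>, such an extension is added on a ball of nearly maximal radius. A point
  there is unmarked only if it is unmarked for the longer flag or if the new member drops below
  \<epsilon> \<rho>; the first is bounded by induction, the second by goodness. A measurable
  superset \<open>N\<close> is bounded, which leaves measurability of the unmarked set out of the
  argument.\<close>

lemma unmarked_measure:
  assumes "flag F" "finite F" "card F + m = n" "0 < r" "ball z (21 ^ m * r) \<subseteq> V"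
    and "\<forall>u\<in>ext F. \<exists>y\<in>ball z r. \<rho> \<le> \<psi> u y" and "0 < \<rho>" "0 < \<epsilon>"
  shows "\<exists>N\<in>lmeasurable. {x \<in> ball z r. \<not> marked F \<rho> \<epsilon> x} \<subseteq> N \<and>
           measure lebesgue N \<le> nd_const C DIM('a) m * \<epsilon> powr \<alpha> * measure lebesgue (ball z r)"
  using assms
proof (induction m arbitrary: F z r)
  case 0
  then have "ext F = {}"
    using flag_full_ext by simp
  then have "marked F \<rho> \<epsilon> x" for x
    using 0 by (auto simp: marked_def)
  then show ?case
    by (intro bexI[of _ "{}"]) auto
next
  case (Suc m)
  note F = \<open>flag F\<close> and r = \<open>0 < r\<close>
  have "r \<le> 21 ^ Suc m * r"
    using r by (simp add: mult_le_cancel_right1 del: power_Suc)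
  then have BV: "ball z r \<subseteq> V"
    using Suc.prems(5) by (meson order_trans subset_ball)
  define E where "E = {x \<in> ball z r. \<exists>s\<in>ext F. \<psi> s x < \<rho>}"
  have "\<forall>x\<in>E. \<exists>s q. s \<in> ext F \<and> 0 < q \<and> q < 2 * r \<and> (\<forall>y\<in>ball x q. \<psi> s y < \<rho>) \<and>
           (\<forall>u\<in>ext F. \<exists>y\<in>ball x (2 * q). \<rho> \<le> \<psi> u y)"
    using almost_maximal_ball[OF BV _ _ _ Suc.prems(6)] unfolding E_def by blast
  then obtain S q where Sq: "\<And>x. x \<in> E \<Longrightarrow> S x \<in> ext F \<and> 0 < q x \<and> q x < 2 * r \<and>
      (\<forall>y\<in>ball x (q x). \<psi> (S x) y < \<rho>) \<and> (\<forall>u\<in>ext F. \<exists>y\<in>ball x (2 * q x). \<rho> \<le> \<psi> u y)"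
    by metis
  have "E \<subseteq> (\<Union>x\<in>E. cball x (q x))"
    using Sq by force
  moreover have "0 < q x \<and> q x \<le> 2 * r" if "x \<in> E" for x
    using Sq[OF that] by simp
  ultimately obtain D where D: "countable D" "D \<subseteq> E"
    "pairwise (\<lambda>i j. disjnt (cball i (q i)) (cball j (q j))) D" "E \<subseteq> (\<Union>i\<in>D. cball i (5 * q i))"
    by (rule Vitali_covering_lemma_cballs[where a = "\<lambda>x. x"])
  \<comment> \<open>Tenfold open balls contain the fivefold closed balls of the covering lemma as
    well as the twofold balls on which every extension reaches \<rho>.\<close>
  let ?Q = "\<lambda>i N. N \<in> lmeasurable \<and> {x \<in> ball i (10 * q i). \<not> marked F \<rho> \<epsilon> x} \<subseteq> N \<and>
      measure lebesgue N \<le> (nd_const C DIM('a) m + C) * 10 ^ DIM('a) * \<epsilon> powr \<alpha> * measure lebesgue (ball i (q i))"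
  have "\<exists>N. ?Q i N"
    if "i \<in> D" for i
  proof -
    have i: "i \<in> E"
      using that D(2) by blast
    note Si = Sq[OF i]
    have s: "S i \<in> P" and q: "0 < q i" "q i < 2 * r"
      using Si by (auto simp: ext_def)
    let ?B = "ball i (10 * q i)"
    \<comment> \<open>The origin of 21: the centre moves by less than r, and the new radius 10 q is
      less than 20 r.\<close>
    have sub: "ball i (21 ^ m * (10 * q i)) \<subseteq> V"
    proof
      fix w assume w: "w \<in> ball i (21 ^ m * (10 * q i))"
      have "dist z w \<le> dist z i + dist i w"
        by (rule dist_triangle)
      also have "\<dots> < r + 21 ^ m * (10 * q i)"
        using w i by (simp add: E_def)
      also have "\<dots> \<le> 21 ^ m * r + 21 ^ m * (20 * r)"
        using r q by (intro add_mono mult_left_mono) auto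
      also have "\<dots> = 21 ^ Suc m * r"
        by simp
      finally show "w \<in> V"
        using Suc.prems(5) by auto
    qed
    have "10 * q i \<le> 21 ^ m * (10 * q i)"
      using q by simp
    then have BV': "?B \<subseteq> V"
      using sub by (meson order_trans subset_ball)
    have large: "\<forall>u\<in>ext F. \<exists>y\<in>?B. \<rho> \<le> \<psi> u y"
    proof
      fix u assume "u \<in> ext F"
      then obtain y where "y \<in> ball i (2 * q i)" "\<rho> \<le> \<psi> u y"
        using Si by blast
      then show "\<exists>y\<in>?B. \<rho> \<le> \<psi> u y"
        using q by (intro bexI[of _ y]) auto
    qed
    have up: "\<psi> (S i) y \<le> K * \<rho>" if "y \<in> ?B" for y
      using doubling[OF s q(1) BV' _ that] Si by blast
    have "finite (insert (S i) F)" "card (insert (S i) F) + m = n"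
      using Suc.prems(2,3) Si by (auto simp: ext_def cmp_def card_insert_if)
    moreover have "\<forall>u\<in>ext (insert (S i) F). \<exists>y\<in>?B. \<rho> \<le> \<psi> u y"
      using large ext_insert_subset by blast
    ultimately obtain N1 where N1: "N1 \<in> lmeasurable"
      "{x \<in> ?B. \<not> marked (insert (S i) F) \<rho> \<epsilon> x} \<subseteq> N1"
      "measure lebesgue N1 \<le> nd_const C DIM('a) m * \<epsilon> powr \<alpha> * measure lebesgue ?B"
      using Suc.IH[of "insert (S i) F" "10 * q i" i] flag_insert[OF F] Si sub q Suc.prems(7,8)
      by auto
    obtain y where y: "y \<in> ?B" "\<rho> \<le> \<psi> (S i) y"
      using large Si by blast
    define N2 where "N2 = {x \<in> ?B. \<psi> (S i) x < \<epsilon> * \<psi> (S i) y}"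
    have N2: "N2 \<in> lmeasurable"
      unfolding N2_def by (rule lmeasurable_sublevel[OF open_V cont[OF s] BV'])
    have abs: "\<bar>\<psi> (S i) z\<bar> = \<psi> (S i) z" for z
      using nonneg[OF s] by simp
    have N2m: "measure lebesgue N2 \<le> C * \<epsilon> powr \<alpha> * measure lebesgue ?B"
      using good[OF s] q BV' y(1) \<open>0 < \<epsilon>\<close> unfolding N2_def pgood_def abs by auto
    \<comment> \<open>Off \<open>N2\<close> the new member is at least \<epsilon> \<rho> at x, and
      off \<open>N1\<close> the longer flag marks x, so \<open>marked_insert\<close>
      applies.\<close>
    have "{x \<in> ?B. \<not> marked F \<rho> \<epsilon> x} \<subseteq> N1 \<union> N2"
    proof (rule subsetI, rule ccontr)
      fix x assume x: "x \<in> {x \<in> ?B. \<not> marked F \<rho> \<epsilon> x}" and "x \<notin> N1 \<union> N2"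
      then have m: "marked (insert (S i) F) \<rho> \<epsilon> x" and "\<epsilon> * \<psi> (S i) y \<le> \<psi> (S i) x"
        using N1(2) by (auto simp: N2_def not_less)
      moreover have "\<epsilon> * \<rho> \<le> \<epsilon> * \<psi> (S i) y"
        using y(2) \<open>0 < \<epsilon>\<close> by simp
      ultimately have "marked F \<rho> \<epsilon> x"
        using x Si F \<open>0 < \<rho>\<close> up large by (intro marked_insert[of F "S i" \<rho> \<epsilon> x ?B]) auto
      then show False using x by simp
    qed
    moreover have "measure lebesgue (N1 \<union> N2) \<le> (nd_const C DIM('a) m + C) * 10 ^ DIM('a) * \<epsilon> powr \<alpha> * measure lebesgue (ball i (q i))"
    proof -
      have "measure lebesgue (N1 \<union> N2) \<le> measure lebesgue N1 + measure lebesgue N2"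
        using N1(1) N2 by (intro measure_Un_le) auto
      also have "\<dots> \<le> (nd_const C DIM('a) m + C) * \<epsilon> powr \<alpha> * measure lebesgue ?B"
        using N1(3) N2m by (simp add: algebra_simps)
      also have "measure lebesgue ?B = 10 ^ DIM('a) * measure lebesgue (ball i (q i))"
        using q by (intro measure_ball_scale) auto
      finally show ?thesis by (simp add: algebra_simps)
    qed
    ultimately show ?thesis
      using N1(1) N2 by (intro exI[of _ "N1 \<union> N2"]) auto
  qed
  then have "\<forall>i\<in>D. \<exists>N. ?Q i N" by (rule ballI)
  from bchoice[OF this] obtain N where NQ: "\<forall>i\<in>D. ?Q i (N i)" by (elim exE)
  have N: "\<And>i. i \<in> D \<Longrightarrow> N i \<in> lmeasurable"
    "\<And>i. i \<in> D \<Longrightarrow> {x \<in> ball i (10 * q i). \<not> marked F \<rho> \<epsilon> x} \<subseteq> N i"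
    "\<And>i. i \<in> D \<Longrightarrow> measure lebesgue (N i) \<le>
       (nd_const C DIM('a) m + C) * 10 ^ DIM('a) * \<epsilon> powr \<alpha> * measure lebesgue (ball i (q i))"
    using NQ by simp_all
  \<comment> \<open>A bound uniform over finite parts of the countable cover passes to the full
    union. The balls have centres in \<open>ball z r\<close> and radii below 2r, hence lie in
    \<open>ball z (3 * r)\<close>.\<close>
  have fin: "measure lebesgue (\<Union>i\<in>I. N i) \<le> nd_const C DIM('a) (Suc m) * \<epsilon> powr \<alpha> * measure lebesgue (ball z r)"
    if I: "I \<subseteq> D" "finite I" for I
  proof -
    have ID: "i \<in> D \<and> i \<in> E \<and> 0 < q i \<and> q i < 2 * r" if "i \<in> I" for i
      using that I(1) D(2) Sq by blast
    have "(\<Sum>i\<in>I. measure lebesgue (ball i (q i))) = measure lebesgue (\<Union>i\<in>I. ball i (q i))"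
    proof (rule measure_UNION'[symmetric])
      show "pairwise (\<lambda>i j. disjnt (ball i (q i)) (ball j (q j))) I"
      proof (rule pairwise_mono[OF D(3)[THEN pairwise_subset[OF _ I(1)]]])
        show "disjnt (ball i (q i)) (ball j (q j))" if "disjnt (cball i (q i)) (cball j (q j))" for i j
          using that ball_subset_cball by (meson disjnt_subset1 disjnt_subset2)
      qed simp
    qed (use I in \<open>auto intro!: sets.finite_UN\<close>)
    also have "\<dots> \<le> measure lebesgue (ball z (3 * r))"
    proof (rule measure_mono_fmeasurable)
      show "(\<Union>i\<in>I. ball i (q i)) \<subseteq> ball z (3 * r)"
      proof
        fix w assume "w \<in> (\<Union>i\<in>I. ball i (q i))"
        then obtain i where "i \<in> I" "dist i w < q i" by auto
        then have "dist z i < r" "dist i w < 2 * r"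
          using ID[of i] by (auto simp: E_def)
        then show "w \<in> ball z (3 * r)"
          using dist_triangle[of z w i] by simp
      qed
    qed (use I in \<open>auto intro!: sets.finite_UN\<close>)
    also have "\<dots> = 3 ^ DIM('a) * measure lebesgue (ball z r)"
      using r by (intro measure_ball_scale) auto
    finally have total: "(\<Sum>i\<in>I. measure lebesgue (ball i (q i))) \<le> 3 ^ DIM('a) * measure lebesgue (ball z r)" .
    have "measure lebesgue (\<Union>i\<in>I. N i) \<le> (\<Sum>i\<in>I. measure lebesgue (N i))"
      using I N(1) by (intro measure_UNION_le) auto
    also have "\<dots> \<le> (\<Sum>i\<in>I. (nd_const C DIM('a) m + C) * 10 ^ DIM('a) * \<epsilon> powr \<alpha> * measure lebesgue (ball i (q i)))"
      using ID N(3) by (intro sum_mono) auto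
    also have "\<dots> = (nd_const C DIM('a) m + C) * 10 ^ DIM('a) * \<epsilon> powr \<alpha> * (\<Sum>i\<in>I. measure lebesgue (ball i (q i)))"
      by (simp add: sum_distrib_left)
    also have "\<dots> \<le> (nd_const C DIM('a) m + C) * 10 ^ DIM('a) * \<epsilon> powr \<alpha> * (3 ^ DIM('a) * measure lebesgue (ball z r))"
      using nd_const_nonneg[of C "DIM('a)" m] C_pos by (intro mult_left_mono[OF total]) simp
    also have "\<dots> = (nd_const C DIM('a) m + C) * (10 ^ DIM('a) * 3 ^ DIM('a)) * \<epsilon> powr \<alpha> * measure lebesgue (ball z r)"
      by simp
    also have "10 ^ DIM('a) * 3 ^ DIM('a) = (30::real) ^ DIM('a)"
      by (simp flip: power_mult_distrib)
    finally show ?thesis by simp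
  qed
  have "(\<Union>i\<in>D. N i) \<in> lmeasurable"
    by (rule fmeasurable_UN_bound[OF D(1) N(1) fin])
  moreover have "measure lebesgue (\<Union>i\<in>D. N i) \<le> nd_const C DIM('a) (Suc m) * \<epsilon> powr \<alpha> * measure lebesgue (ball z r)"
    by (rule measure_UN_bound[OF D(1) N(1) fin])
  moreover have "{x \<in> ball z r. \<not> marked F \<rho> \<epsilon> x} \<subseteq> (\<Union>i\<in>D. N i)"
  proof
    fix x assume x: "x \<in> {x \<in> ball z r. \<not> marked F \<rho> \<epsilon> x}"
    \<comment> \<open>Outside \<open>E\<close> the flag \<open>F\<close> itself is a witness for
      \<open>marked\<close>.\<close>
    have "x \<in> E"
    proof (rule ccontr)
      assume "x \<notin> E"
      then have "\<forall>s\<in>ext F. \<rho> \<le> \<psi> s x"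
        using x by (auto simp: E_def not_less)
      then have "marked F \<rho> \<epsilon> x"
        using F by (auto simp: marked_def)
      then show False using x by simp
    qed
    then obtain i where i: "i \<in> D" "x \<in> cball i (5 * q i)"
      using D(4) by blast
    moreover have "0 < q i"
      using Sq i(1) D(2) by blast
    ultimately have "x \<in> ball i (10 * q i)" by simp
    then show "x \<in> (\<Union>i\<in>D. N i)"
      using N(2)[OF i(1)] i(1) x by blast
  qed
  ultimately show ?case by blast
qed

end

section \<open>The Dani correspondence\<close>

lemma abs_le_Pi_plus:
  assumes "i \<in> {1..n}"
  shows "\<bar>real_of_int (q i)\<bar> \<le> Pi_plus n q"
proof -
  have "max \<bar>real_of_int (q i)\<bar> 1 * 1 \<le>
        max \<bar>real_of_int (q i)\<bar> 1 * (\<Prod>j\<in>{1..n} - {i}. max \<bar>real_of_int (q j)\<bar> 1)"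
    by (intro mult_left_mono prod_ge_1) auto
  then show ?thesis
    unfolding Pi_plus_def using assms by (subst prod.remove[of _ i]) auto
qed

lemma Pi_plus_ge_1: "1 \<le> Pi_plus n q"
  unfolding Pi_plus_def by (intro prod_ge_1) auto

lemma finite_Pi_plus_le: "finite {q \<in> int_vecs n. Pi_plus n q \<le> M}"
proof (rule finite_subset)
  let ?F = "\<lambda>g i. if i \<in> {1..n} then g i else (0::int)"
  show "{q \<in> int_vecs n. Pi_plus n q \<le> M} \<subseteq> ?F ` ({1..n} \<rightarrow>\<^sub>E {- \<lceil>M\<rceil>..\<lceil>M\<rceil>})"
  proof
    fix q assume q: "q \<in> {q \<in> int_vecs n. Pi_plus n q \<le> M}"
    have "q i \<in> {- \<lceil>M\<rceil>..\<lceil>M\<rceil>}" if "i \<in> {1..n}" for i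
    proof -
      have "Pi_plus n q \<le> M"
        using q by simp
      then have "\<bar>real_of_int (q i)\<bar> \<le> of_int \<lceil>M\<rceil>"
        using abs_le_Pi_plus[OF that, of q] le_of_int_ceiling[of M] by linarith
      then show ?thesis by (auto simp: abs_le_iff)
    qed
    then have "restrict q {1..n} \<in> {1..n} \<rightarrow>\<^sub>E {- \<lceil>M\<rceil>..\<lceil>M\<rceil>}"
      by simp
    moreover have "q = ?F (restrict q {1..n})"
      using q by (auto simp: int_vecs_def fun_eq_iff)
    ultimately show "q \<in> ?F ` ({1..n} \<rightarrow>\<^sub>E {- \<lceil>M\<rceil>..\<lceil>M\<rceil>})"
      by blast
  qed
  show "finite (?F ` ({1..n} \<rightarrow>\<^sub>E {- \<lceil>M\<rceil>..\<lceil>M\<rceil>}))"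
    by (intro finite_imageI finite_PiE) auto
qed

text \<open>For a good approximation q with L = ln \<Pi>_+(q), take t_i slightly larger than ln
  max(|q_i|, 1). This contracts the coordinates 1, ..., n, while the total t exceeds L so little
  that the approximation quality still beats the expansion by e^t. Rounding t to integers leaves
  countably many times for the measure argument.\<close>

lemma VWMA_imp_short_vectors:
  assumes "n \<ge> 1" "VWMA n y"
  shows "\<exists>\<gamma>>0. \<forall>T. \<exists>\<tau>::nat \<Rightarrow> nat. T \<le> (\<Sum>i=1..n. \<tau> i) \<and>
    (\<exists>v. (\<forall>i>n. v i = 0) \<and> v \<noteq> (\<lambda>_. 0) \<and>
      vnorm n (gu_act n (\<lambda>i. real (\<tau> i)) y (rvec v)) \<le> exp (- \<gamma> * real (\<Sum>i=1..n. \<tau> i)))"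
proof -
  obtain w where w: "real n < w" and inf: "infinite {q \<in> int_vecs n. \<exists>p::int.
      \<bar>(\<Sum>i=1..n. y i * of_int (q i)) + of_int p\<bar> \<le> Pi_plus n q powr (- w / real n)}"
    using assms(2) unfolding VWMA_def by blast
  \<comment> \<open>The excess \<kappa> of w/n over 1 is split into n + 2 shares \<eta>: n pay for
    enlarging the t_i, one pays for rounding once n \<le> \<eta> L, and one remains as contraction.
    Since t \<le> (1 + n \<eta> + \<eta>) L, the contraction e^(-\<eta> L) is at most e^(-\<gamma>
    t).\<close>
  define \<kappa> where "\<kappa> = w / n - 1"
  define \<eta> where "\<eta> = \<kappa> / (n + 2)"
  define \<gamma> where "\<gamma> = \<eta> / (1 + n * \<eta> + \<eta>)"
  have \<kappa>: "0 < \<kappa>"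
    using w assms(1) by (simp add: \<kappa>_def field_simps)
  have \<eta>: "0 < \<eta>" "\<kappa> = (n + 2) * \<eta>"
    using \<kappa> by (auto simp: \<eta>_def)
  have den: "0 < 1 + n * \<eta> + \<eta>"
    using \<eta>(1) by (intro add_pos_pos add_pos_nonneg) auto
  have \<gamma>: "0 < \<gamma>" "\<gamma> * (1 + n * \<eta> + \<eta>) = \<eta>"
    using \<eta>(1) den by (auto simp: \<gamma>_def)
  have "\<exists>\<tau>::nat \<Rightarrow> nat. T \<le> (\<Sum>i=1..n. \<tau> i) \<and>
    (\<exists>v. (\<forall>i>n. v i = 0) \<and> v \<noteq> (\<lambda>_. 0) \<and>
      vnorm n (gu_act n (\<lambda>i. real (\<tau> i)) y (rvec v)) \<le> exp (- \<gamma> * real (\<Sum>i=1..n. \<tau> i)))" for T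
  proof -
    \<comment> \<open>\<open>Pi_plus n q\<close> above \<open>M\<close> gives both L > T, hence t
      \<ge> T, and n \<le> \<eta> L.\<close>
    define M where "M = exp (max (real T) (n / \<eta>))"
    have "\<not> {q \<in> int_vecs n. \<exists>p::int.
      \<bar>(\<Sum>i=1..n. y i * of_int (q i)) + of_int p\<bar> \<le> Pi_plus n q powr (- w / real n)} \<subseteq> {q \<in> int_vecs n. Pi_plus n q \<le> M}"
      using inf finite_subset[OF _ finite_Pi_plus_le[of n M]] by blast
    then obtain q where "q \<in> {q \<in> int_vecs n. \<exists>p::int.
      \<bar>(\<Sum>i=1..n. y i * of_int (q i)) + of_int p\<bar> \<le> Pi_plus n q powr (- w / real n)}"
      "q \<notin> {q \<in> int_vecs n. Pi_plus n q \<le> M}"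
      by blast
    then obtain p :: int where q: "q \<in> int_vecs n" "M < Pi_plus n q"
      and p: "\<bar>(\<Sum>i=1..n. y i * of_int (q i)) + of_int p\<bar> \<le> Pi_plus n q powr (- w / real n)"
      by auto
    define L where "L = ln (Pi_plus n q)"
    have Pi: "Pi_plus n q = exp L"
      using Pi_plus_ge_1[of n q] by (simp add: L_def)
    have L: "max (real T) (n / \<eta>) < L"
      using q(2) unfolding M_def Pi by simp
    have n_le: "n \<le> \<eta> * L"
      using L \<eta>(1) by (simp add: field_simps)
    have L0: "0 < L"
      using L \<eta>(1) by (auto intro: le_less_trans[of 0 "real T"])
    define m where "m i = max \<bar>real_of_int (q i)\<bar> 1" for i
    have m: "1 \<le> m i" for i by (simp add: m_def)
    have sum_ln: "(\<Sum>i=1..n. ln (m i)) = L"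
      unfolding L_def Pi_plus_def m_def by (rule ln_prod[symmetric]) auto
    define \<tau> where "\<tau> i = nat \<lceil>ln (m i) + \<eta> * L\<rceil>" for i
    have x0: "0 \<le> ln (m i) + \<eta> * L" for i
      using m[of i] \<eta>(1) L0 by simp
    have \<tau>_ge: "ln (m i) + \<eta> * L \<le> real (\<tau> i)" for i
      unfolding \<tau>_def by (rule real_nat_ceiling_ge)
    have \<tau>_le: "real (\<tau> i) \<le> ln (m i) + \<eta> * L + 1" for i
      unfolding \<tau>_def using x0[of i] by (simp add: of_nat_nat)
    define t where "t = real (\<Sum>i=1..n. \<tau> i)"
    have "L + n * (\<eta> * L) \<le> t"
    proof -
      have "(\<Sum>i=1..n. ln (m i) + \<eta> * L) \<le> t"
        unfolding t_def of_nat_sum by (intro sum_mono \<tau>_ge)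
      then show ?thesis unfolding sum.distrib sum_ln by simp
    qed
    moreover have "0 \<le> n * (\<eta> * L)"
      using \<eta>(1) L0 by simp
    ultimately have "real T \<le> t"
      using L by linarith
    then have T: "T \<le> (\<Sum>i=1..n. \<tau> i)"
      unfolding t_def of_nat_le_iff .
    have t_le: "t \<le> L + n * (\<eta> * L) + n"
    proof -
      have "t \<le> (\<Sum>i=1..n. ln (m i) + \<eta> * L + 1)"
        unfolding t_def of_nat_sum by (intro sum_mono \<tau>_le)
      then show ?thesis unfolding sum.distrib sum_ln by simp
    qed
    have t_exp: "exp (- \<eta> * L) \<le> exp (- \<gamma> * t)"
    proof -
      have "\<gamma> * t \<le> \<gamma> * (L + n * (\<eta> * L) + \<eta> * L)"
        using t_le n_le \<gamma>(1) by (intro mult_left_mono) auto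
      also have "\<dots> = \<gamma> * (1 + n * \<eta> + \<eta>) * L"
        by (simp add: algebra_simps)
      finally show ?thesis
        unfolding \<gamma>(2) by simp
    qed
    define v where "v i = (if i = 0 then p else q i)" for i
    have supp: "\<forall>i>n. v i = 0"
      using q(1) by (simp add: v_def int_vecs_def)
    have "v \<noteq> (\<lambda>_. 0)"
    proof
      assume "v = (\<lambda>_. 0)"
      then have "q i = 0" if "i \<in> {1..n}" for i
        using that by (auto simp: v_def fun_eq_iff dest: spec[of _ i])
      then have "Pi_plus n q = 1"
        by (simp add: Pi_plus_def)
      then show False
        using Pi L0 by simp
    qed
    moreover have "vnorm n (gu_act n (\<lambda>i. real (\<tau> i)) y (rvec v)) \<le> exp (- \<eta> * L)"
    proof (rule vnorm_leI)
      fix i assume i: "i \<le> n"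
      show "\<bar>gu_act n (\<lambda>i. real (\<tau> i)) y (rvec v) i\<bar> \<le> exp (- \<eta> * L)"
      proof (cases "i = 0")
        case True
        have "(\<Sum>j=1..n. y j * rvec v j) = (\<Sum>j=1..n. y j * of_int (q j))"
          by (rule sum.cong) (auto simp: rvec_def v_def)
        then have "\<bar>gu_act n (\<lambda>i. real (\<tau> i)) y (rvec v) i\<bar> =
            exp t * \<bar>(\<Sum>i=1..n. y i * of_int (q i)) + of_int p\<bar>"
          using True by (simp add: gu_act_def abs_mult t_def rvec_def v_def add.commute)
        also have "\<dots> \<le> exp t * Pi_plus n q powr (- w / real n)"
          using p by simp
        also have "\<dots> = exp (t - (1 + \<kappa>) * L)"
        proof -
          have "- w / real n * L = - ((1 + \<kappa>) * L)"
            by (simp add: \<kappa>_def)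
          then show ?thesis
            unfolding Pi by (simp add: powr_def exp_add[symmetric])
        qed
        also have "\<dots> \<le> exp (- \<eta> * L)"
        proof -
          have "t - (1 + \<kappa>) * L \<le> L + n * (\<eta> * L) + n - (1 + (n + 2) * \<eta>) * L"
            using t_le \<eta>(2) by simp
          also have "\<dots> = n - 2 * (\<eta> * L)"
            by (simp add: algebra_simps)
          finally show ?thesis using n_le by simp
        qed
        finally show ?thesis .
      next
        case False
        have "\<bar>gu_act n (\<lambda>i. real (\<tau> i)) y (rvec v) i\<bar> = exp (- real (\<tau> i)) * \<bar>real_of_int (q i)\<bar>"
          using False i by (simp add: gu_act_def rvec_def v_def abs_mult)
        also have "\<dots> \<le> exp (- (ln (m i) + \<eta> * L)) * m i"
          using \<tau>_ge[of i] by (intro mult_mono) (auto simp: m_def)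
        also have "\<dots> = exp (- \<eta> * L)"
          using m[of i] by (simp add: exp_diff exp_minus field_simps)
        finally show ?thesis .
      qed
    qed
    ultimately have "v \<noteq> (\<lambda>_. 0)" "vnorm n (gu_act n (\<lambda>i. real (\<tau> i)) y (rvec v)) \<le> exp (- \<gamma> * t)"
      using t_exp by linarith+
    then show ?thesis
      using T supp unfolding t_def by (intro exI[of _ \<tau>] conjI exI[of _ v]) assumption+
  qed
  then show ?thesis
    using \<gamma>(1) by blast
qed

text \<open>A short vector (p, q) at time t satisfies \<Pi>_+(q) \<le> e^t and |f q + p| < e^(-(1 +
  \<beta>) t), which makes q a solution with exponent n (1 + \<beta>). If only finitely many q
  arose, their distances to the integers would be bounded below, contradicting large t.\<close>

lemma short_vectors_imp_VWMA:
  assumes "n \<ge> 1" "0 < \<beta>"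
    and short: "\<And>T. \<exists>t v. (\<forall>i\<in>{1..n}. 0 \<le> t i) \<and> T \<le> (\<Sum>i=1..n. t i) \<and> (\<forall>i>n. v i = 0) \<and>
      v \<noteq> (\<lambda>_. 0) \<and> vnorm n (gu_act n t y (rvec v)) < exp (- \<beta> * (\<Sum>i=1..n. t i))"
  shows "VWMA n y"
proof -
  define w where "w = n * (1 + \<beta>)"
  have w: "real n < w" "w / n = 1 + \<beta>"
    using assms(1,2) by (auto simp: w_def)
  define l where "l q = (\<Sum>i=1..n. y i * of_int (q i))" for q :: "nat \<Rightarrow> int"
  define S where "S = {q \<in> int_vecs n. \<exists>p::int. \<bar>l q + of_int p\<bar> \<le> Pi_plus n q powr (- w / real n)}"
  have "infinite S"
  proof
    assume fin: "finite S"
    \<comment> \<open>An exact relation would make all multiples of q solutions.\<close>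
    have irrational: "l q + of_int p \<noteq> 0" if q: "q \<in> int_vecs n" "q \<noteq> (\<lambda>_. 0)" for q p
    proof
      assume eq: "l q + of_int p = 0"
      have "(\<lambda>i. int k * q i) \<in> S" for k
      proof -
        have "l (\<lambda>i. int k * q i) + of_int (int k * p) = real k * (l q + of_int p)"
          unfolding l_def by (simp add: sum_distrib_left algebra_simps)
        then have "\<bar>l (\<lambda>i. int k * q i) + of_int (int k * p)\<bar> \<le> Pi_plus n (\<lambda>i. int k * q i) powr (- w / real n)"
          using eq by simp
        moreover have "(\<lambda>i. int k * q i) \<in> int_vecs n"
          using q(1) by (simp add: int_vecs_def)
        ultimately show ?thesis
          unfolding S_def mem_Collect_eq by (intro conjI exI[of _ "int k * p"])
      qed
      moreover have "inj (\<lambda>k i. int k * q i)"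
      proof (rule injI)
        fix a b assume "(\<lambda>i. int a * q i) = (\<lambda>i. int b * q i)"
        moreover obtain i where "q i \<noteq> 0"
          using q(2) by auto
        ultimately show "a = b"
          by (metis mult_right_cancel of_nat_eq_iff)
      qed
      ultimately have "infinite S"
        using infinite_super[of "range (\<lambda>k i. int k * q i)" S] finite_imageD[of "\<lambda>k i. int k * q i" UNIV]
        by blast
      then show False using fin by simp
    qed
    define d where "d q = \<bar>l q - of_int (round (l q))\<bar>" for q
    \<comment> \<open>The smallest distance over the nonzero solutions; the element 1 only keeps the
      set nonempty.\<close>
    define D where "D = insert 1 (d ` (S - {\<lambda>_. 0}))"
    have D: "finite D" "D \<noteq> {}"
      using fin by (auto simp: D_def)
    have "0 < d q" if "q \<in> S" "q \<noteq> (\<lambda>_. 0)" for q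
      using irrational[of q "- round (l q)"] that by (auto simp: d_def S_def)
    then have "0 < Min D"
      using D by (auto simp: D_def)
    obtain t v where t: "\<forall>i\<in>{1..n}. 0 \<le> t i" "max 0 (- ln (Min D)) \<le> (\<Sum>i=1..n. t i)"
      and v: "\<forall>i>n. v i = 0" "v \<noteq> (\<lambda>_. 0)"
        "vnorm n (gu_act n t y (rvec v)) < exp (- \<beta> * (\<Sum>i=1..n. t i))"
      using short by blast
    define s where "s = (\<Sum>i=1..n. t i)"
    have s: "0 \<le> s" "exp (- s) \<le> Min D"
    proof -
      show "0 \<le> s" using t(2) by (simp add: s_def)
      have "- s \<le> ln (Min D)" using t(2) by (simp add: s_def)
      then show "exp (- s) \<le> Min D"
        using \<open>0 < Min D\<close> by (metis exp_le_cancel_iff exp_ln)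
    qed
    define q where "q i = (if i = 0 then 0 else v i)" for i
    have q: "q \<in> int_vecs n"
      using v(1) by (auto simp: q_def int_vecs_def)
    have comp: "\<bar>gu_act n t y (rvec v) i\<bar> < exp (- \<beta> * s)" if "i \<le> n" for i
      using abs_le_vnorm[OF that, of "gu_act n t y (rvec v)"] v(3) unfolding s_def by linarith
    have "(\<Sum>j=1..n. y j * rvec v j) = l q"
      unfolding l_def by (rule sum.cong) (auto simp: rvec_def q_def)
    then have "\<bar>gu_act n t y (rvec v) 0\<bar> = exp s * \<bar>l q + of_int (v 0)\<bar>"
      by (simp add: gu_act_def abs_mult s_def rvec_def add.commute)
    then have "exp s * \<bar>l q + of_int (v 0)\<bar> < exp (- \<beta> * s)"
      using comp[of 0] by simp
    also have "exp (- \<beta> * s) = exp s * exp (- (1 + \<beta>) * s)"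
      by (simp add: exp_add[symmetric] algebra_simps)
    finally have small: "\<bar>l q + of_int (v 0)\<bar> < exp (- (1 + \<beta>) * s)"
      by simp
    have "Pi_plus n q \<le> (\<Prod>i=1..n. exp (t i))"
      unfolding Pi_plus_def
    proof (rule prod_mono, rule conjI)
      fix i assume i: "i \<in> {1..n}"
      have "exp (- t i) * \<bar>real_of_int (q i)\<bar> < exp (- \<beta> * s)"
        using comp[of i] i by (simp add: gu_act_def abs_mult rvec_def q_def)
      also have "\<dots> \<le> 1"
        using s(1) assms(2) by simp
      finally have "\<bar>real_of_int (q i)\<bar> \<le> exp (t i)"
        by (simp add: exp_minus field_simps)
      then show "max \<bar>real_of_int (q i)\<bar> 1 \<le> exp (t i)"
        using t(1) i by simp
    qed simp
    then have Pi: "Pi_plus n q \<le> exp s"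
      by (simp add: s_def exp_sum)
    have "exp (- (1 + \<beta>) * s) = exp s powr (- w / real n)"
      using w(2) by (simp add: powr_def)
    also have "\<dots> \<le> Pi_plus n q powr (- w / real n)"
    proof (rule powr_mono2')
      show "- w / real n \<le> 0"
        using w(2) assms(2) by simp
    qed (use Pi Pi_plus_ge_1[of n q] in auto)
    finally have qS: "q \<in> S"
      using small q unfolding S_def by (auto intro!: exI[of _ "v 0"])
    have "- (1 + \<beta>) * s \<le> - s"
      using s(1) assms(2) by (simp add: algebra_simps)
    then have lt: "\<bar>l q + of_int (v 0)\<bar> < exp (- s)"
      using small by (meson exp_le_cancel_iff less_le_trans)
    \<comment> \<open>For q = 0 the integer \<open>v 0\<close> would have absolute value below 1, so
      the whole vector would vanish.\<close>
    have "q \<noteq> (\<lambda>_. 0)"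
    proof
      assume q0: "q = (\<lambda>_. 0)"
      then have "l q = 0" by (simp add: l_def)
      moreover have "exp (- s) \<le> 1" using s(1) by simp
      moreover have "\<bar>real_of_int (v 0)\<bar> < exp (- s)"
        using lt \<open>l q = 0\<close> by simp
      ultimately have "\<bar>real_of_int (v 0)\<bar> < 1"
        by linarith
      then have "v 0 = 0" by linarith
      then have "v i = 0" for i
        using fun_cong[OF q0, of i] by (cases "i = 0") (auto simp: q_def)
      then show False using v(2) by blast
    qed
    then have "Min D \<le> d q"
      using D qS by (intro Min_le) (auto simp: D_def)
    also have "d q \<le> \<bar>l q - of_int (- v 0)\<bar>"
      unfolding d_def by (rule round_diff_minimal)
    finally show False
      using lt s(2) by simp
  qed
  then show ?thesis
    unfolding VWMA_def S_def l_def using w(1) by blast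
qed

lemma not_VWMA_imp_gu_norm_ge:
  assumes "n \<ge> 1" "\<not> VWMA n y" "0 < \<beta>"
  shows "\<exists>T>0. \<forall>t. (\<forall>i\<in>{1..n}. 0 \<le> t i) \<longrightarrow> T \<le> (\<Sum>i=1..n. t i) \<longrightarrow>
     (\<forall>vs. S_basis n vs \<longrightarrow> exp (- \<beta> * (\<Sum>i=1..n. t i)) \<le> gu_norm n t y vs)"
proof -
  \<comment> \<open>Half of \<beta> pays for up to n factors of the shortest length, the other half
    for the constant of Hermite's bound once t is large.\<close>
  define \<beta>' where "\<beta>' = \<beta> / (2 * n)"
  have \<beta>': "0 < \<beta>'" "n * \<beta>' = \<beta> / 2"
    using assms(1,3) by (auto simp: \<beta>'_def)
  define bad where "bad T t v \<longleftrightarrow> (\<forall>i\<in>{1..n}. 0 \<le> t i) \<and> T \<le> (\<Sum>i=1..n. t i) \<and> (\<forall>i>n. v i = 0) \<and>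
      v \<noteq> (\<lambda>_. 0) \<and> vnorm n (gu_act n t y (rvec v)) < exp (- \<beta>' * (\<Sum>i=1..n. t i))" for T t v
  have "\<exists>T. \<forall>t v. \<not> bad T t v"
  proof (rule ccontr)
    assume "\<nexists>T. \<forall>t v. \<not> bad T t v"
    then have "\<exists>t v. bad T t v" for T by simp
    then have "VWMA n y"
      unfolding bad_def by (rule short_vectors_imp_VWMA[OF assms(1) \<beta>'(1)])
    then show False using assms(2) by simp
  qed
  then obtain T0 where T0: "\<And>t v. \<not> bad T0 t v" by blast
  define a where "a = ((9/20)::real) ^ (n * n)"
  have a: "0 < a" by (simp add: a_def)
  define T where "T = max 1 (max T0 (- 2 / \<beta> * ln a))"
  have "exp (- \<beta> * s) \<le> gu_norm n t y vs"
    if t: "\<forall>i\<in>{1..n}. 0 \<le> t i" and s: "s = (\<Sum>i=1..n. t i)" "T \<le> s" and vs: "S_basis n vs" for t vs s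
  proof -
    have len: "length vs \<le> n"
      using vs by (simp add: S_basis_def)
    have s0: "0 \<le> s"
      using s(2) by (simp add: T_def)
    have "- 2 / \<beta> * ln a \<le> s"
      using s(2) by (simp add: T_def)
    then have "- (\<beta> / 2) * s \<le> ln a"
      using assms(3) by (simp add: field_simps)
    then have as: "exp (- (\<beta> / 2) * s) \<le> a"
      using a by (metis exp_le_cancel_iff exp_ln)
    have "exp (- \<beta> * s) = exp (- (\<beta> / 2) * s) * exp (- \<beta>' * s) ^ n"
    proof -
      have "- (\<beta> / 2) * s + real n * (- \<beta>' * s) = - (\<beta> / 2) * s - (n * \<beta>') * s"
        by simp
      also have "\<dots> = - \<beta> * s"
        unfolding \<beta>'(2) by simp
      finally show ?thesis
        by (simp only: exp_of_nat_mult[symmetric] exp_add[symmetric])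
    qed
    also have "\<dots> \<le> (9/20) ^ (length vs * length vs) * exp (- \<beta>' * s) ^ length vs"
    proof (rule mult_mono)
      have "a \<le> (9/20) ^ (length vs * length vs)"
        unfolding a_def using len by (intro power_decreasing mult_mono) auto
      then show "exp (- (\<beta> / 2) * s) \<le> (9/20) ^ (length vs * length vs)"
        using as by linarith
      show "exp (- \<beta>' * s) ^ n \<le> exp (- \<beta>' * s) ^ length vs"
        using len s0 \<beta>'(1) by (intro power_decreasing) auto
    qed auto
    also have "\<dots> \<le> gu_norm n t y vs"
    proof (rule gu_norm_ge_shortest[OF vs])
      fix v :: "nat \<Rightarrow> int" assume v: "\<forall>i>n. v i = 0" "v \<noteq> (\<lambda>_. 0)"
      have "T0 \<le> (\<Sum>i=1..n. t i)"
        using s by (simp add: T_def)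
      then show "exp (- \<beta>' * s) \<le> vnorm n (gu_act n t y (rvec v))"
        using T0[of t v] t v unfolding bad_def s(1) by (simp only: not_less simp_thms) simp
    qed simp
    finally show ?thesis .
  qed
  then show ?thesis
    by (intro exI[of _ T]) (auto simp: T_def)
qed

section \<open>Integer subgroups under the flow\<close>

text \<open>Independence without the length bounds of \<open>S_basis\<close>, for the empty list and
  for lists of full rank n + 1, both of which occur when a vector is adjoined to a member of a
  flag.\<close>

definition indep :: "(nat \<Rightarrow> int) list \<Rightarrow> bool" where
  "indep vs \<longleftrightarrow> (\<forall>c::nat \<Rightarrow> real. (\<forall>i. (\<Sum>k<length vs. c k * rvec (vs ! k) i) = 0) \<longrightarrow>
     (\<forall>k<length vs. c k = 0))"

lemma S_basis_iff:
  "S_basis n vs \<longleftrightarrow> 1 \<le> length vs \<and> length vs \<le> n \<and> (\<forall>v\<in>set vs. \<forall>i>n. v i = 0) \<and> indep vs"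
  unfolding S_basis_def indep_def rvec_def by (rule refl)

text \<open>Real span rather than generated subgroup: bases with equal spans have proportional
  covolumes, which is the form in which the flags compare them.\<close>

definition in_span :: "(nat \<Rightarrow> int) list \<Rightarrow> (nat \<Rightarrow> int) \<Rightarrow> bool" where
  "in_span vs v \<longleftrightarrow> (\<exists>c. \<forall>i. rvec v i = (\<Sum>k<length vs. rvec (vs ! k) i * c k))"

lemma in_spanI: "(\<And>i. rvec v i = (\<Sum>k<length vs. rvec (vs ! k) i * c k)) \<Longrightarrow> in_span vs v"
  unfolding in_span_def by (intro exI[of _ c]) simp

definition span_le :: "(nat \<Rightarrow> int) list \<Rightarrow> (nat \<Rightarrow> int) list \<Rightarrow> bool" where
  "span_le vs ws \<longleftrightarrow> (\<forall>v\<in>set vs. in_span ws v)"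

lemma span_le_coeff:
  assumes "span_le vs ws"
  obtains c where "\<And>b i. b < length vs \<Longrightarrow> rvec (vs ! b) i = (\<Sum>k<length ws. rvec (ws ! k) i * c k b)"
proof -
  have "\<forall>b. \<exists>c. b < length vs \<longrightarrow> (\<forall>i. rvec (vs ! b) i = (\<Sum>k<length ws. rvec (ws ! k) i * c k))"
    using assms unfolding span_le_def in_span_def by (metis nth_mem)
  from choice[OF this] obtain c where
    "\<forall>b. b < length vs \<longrightarrow> (\<forall>i. rvec (vs ! b) i = (\<Sum>k<length ws. rvec (ws ! k) i * c b k))"
    by (elim exE)
  then show ?thesis
    by (intro that[of "\<lambda>k b. c b k"]) simp
qed

lemma in_span_trans:
  assumes "in_span vs v" "span_le vs ws"
  shows "in_span ws v"
proof -
  obtain c where c: "\<And>b i. b < length vs \<Longrightarrow> rvec (vs ! b) i = (\<Sum>k<length ws. rvec (ws ! k) i * c k b)"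
    using span_le_coeff[OF assms(2)] by blast
  obtain d where d: "\<And>i. rvec v i = (\<Sum>b<length vs. rvec (vs ! b) i * d b)"
    using assms(1) unfolding in_span_def by blast
  have "rvec v i = (\<Sum>k<length ws. rvec (ws ! k) i * (\<Sum>b<length vs. c k b * d b))" for i
  proof -
    have "rvec v i = (\<Sum>b<length vs. (\<Sum>k<length ws. rvec (ws ! k) i * c k b * d b))"
      unfolding d by (intro sum.cong) (auto simp: c sum_distrib_right)
    also have "\<dots> = (\<Sum>k<length ws. \<Sum>b<length vs. rvec (ws ! k) i * c k b * d b)"
      by (rule sum.swap)
    finally show ?thesis
      by (simp add: sum_distrib_left mult.assoc)
  qed
  then show ?thesis
    by (rule in_spanI)
qed

lemma span_le_trans: "span_le us vs \<Longrightarrow> span_le vs ws \<Longrightarrow> span_le us ws"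
  unfolding span_le_def[of us] by (blast intro: in_span_trans)

lemma in_span_mem:
  assumes "v \<in> set vs"
  shows "in_span vs v"
proof -
  obtain b where b: "b < length vs" "vs ! b = v"
    using assms by (auto simp: in_set_conv_nth)
  have "rvec v i = (\<Sum>k<length vs. rvec (vs ! k) i * (if k = b then 1 else 0))" for i
  proof -
    have "(\<Sum>k<length vs. rvec (vs ! k) i * (if k = b then 1 else 0)) =
          (\<Sum>k<length vs. if k = b then rvec (vs ! b) i else 0)"
      by (rule sum.cong) auto
    then show ?thesis using b by simp
  qed
  then show ?thesis
    unfolding in_span_def by (intro exI[of _ "\<lambda>k. if k = b then 1 else 0"]) simp
qed

lemma in_span_Nil: "in_span [] v \<longleftrightarrow> v = (\<lambda>_. 0)"
  by (simp add: in_span_def rvec_def fun_eq_iff)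

lemma span_le_Cons_right: "span_le vs (v # vs)"
  unfolding span_le_def by (auto intro: in_span_mem)

text \<open>A kernel vector of \<open>c\<close> would be a linear relation among the
  \<open>V b\<close>. Stated for families, so that \<open>W\<close> can be another basis as well as
  the standard one.\<close>

lemma coeff_det_nonzero:
  fixes V W c :: "nat \<Rightarrow> nat \<Rightarrow> real"
  assumes ind: "\<And>d. (\<And>i. (\<Sum>b<k. d b * V b i) = 0) \<Longrightarrow> \<forall>b<k. d b = 0"
    and V: "\<And>b i. b < k \<Longrightarrow> V b i = (\<Sum>a<k. W a i * c a b)"
  shows "ldet k c \<noteq> 0"
proof
  assume "ldet k c = 0"
  then obtain d where d: "\<exists>b<k. d b \<noteq> 0" "\<And>a. a < k \<Longrightarrow> (\<Sum>b<k. c a b * d b) = 0"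
    by (rule ldet_eq_0_kernel) blast
  have "(\<Sum>b<k. d b * V b i) = 0" for i
  proof -
    have "(\<Sum>b<k. d b * V b i) = (\<Sum>b<k. \<Sum>a<k. W a i * (c a b * d b))"
      by (intro sum.cong) (auto simp: V sum_distrib_left mult_ac)
    also have "\<dots> = (\<Sum>a<k. \<Sum>b<k. W a i * (c a b * d b))"
      by (rule sum.swap)
    also have "\<dots> = 0"
      by (intro sum.neutral) (auto simp: d(2) sum_distrib_left[symmetric])
    finally show ?thesis .
  qed
  then show False
    using ind d(1) by blast
qed

text \<open>Independence of \<open>vs\<close> makes the square coefficient matrix invertible, and
  its inverse expresses \<open>ws\<close> through \<open>vs\<close>.\<close>

lemma span_le_sym:
  assumes "indep vs" "length vs = length ws" "span_le vs ws"
  shows "span_le ws vs"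
proof -
  let ?k = "length ws"
  obtain c where c: "\<And>b i. b < length vs \<Longrightarrow> rvec (vs ! b) i = (\<Sum>k<?k. rvec (ws ! k) i * c k b)"
    using span_le_coeff[OF assms(3)] by blast
  have "ldet ?k c \<noteq> 0"
  proof (rule coeff_det_nonzero[where V = "\<lambda>b. rvec (vs ! b)" and W = "\<lambda>a. rvec (ws ! a)"])
    show "\<forall>b<?k. d b = 0" if "\<And>i. (\<Sum>b<?k. d b * rvec (vs ! b) i) = 0" for d
      using assms(1,2) that unfolding indep_def by simp
  qed (use c assms(2) in simp)
  then obtain B where B: "\<And>a b. a < ?k \<Longrightarrow> b < ?k \<Longrightarrow> (\<Sum>e<?k. c a e * B e b) = (if a = b then 1 else 0)"
    by (rule ldet_nonzero_inverse) blast
  have "in_span vs (ws ! a)" if a: "a < ?k" for a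
  proof -
    have "rvec (ws ! a) i = (\<Sum>b<length vs. rvec (vs ! b) i * B b a)" for i
    proof -
      have "(\<Sum>b<length vs. rvec (vs ! b) i * B b a) = (\<Sum>b<?k. \<Sum>e<?k. rvec (ws ! e) i * (c e b * B b a))"
        unfolding assms(2) by (intro sum.cong) (auto simp: c assms(2) sum_distrib_right mult.assoc)
      also have "\<dots> = (\<Sum>e<?k. \<Sum>b<?k. rvec (ws ! e) i * (c e b * B b a))"
        by (rule sum.swap)
      also have "\<dots> = (\<Sum>e<?k. if e = a then rvec (ws ! e) i else 0)"
        using a by (intro sum.cong) (auto simp: B sum_distrib_left[symmetric])
      finally show ?thesis using a by simp
    qed
    then show ?thesis by (rule in_spanI)
  qed
  then show ?thesis
    unfolding span_le_def by (metis in_set_conv_nth)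
qed

lemma gu_act_sum:
  assumes "\<And>i. v i = (\<Sum>k<m. w k i * c k)"
  shows "gu_act n t y v i = (\<Sum>k<m. gu_act n t y (w k) i * c k)"
proof -
  have "(\<Sum>j=1..n. y j * v j) = (\<Sum>k<m. (\<Sum>j=1..n. y j * w k j) * c k)"
  proof -
    have "(\<Sum>j=1..n. y j * v j) = (\<Sum>j=1..n. \<Sum>k<m. y j * w k j * c k)"
      by (simp add: assms sum_distrib_left mult.assoc)
    also have "\<dots> = (\<Sum>k<m. \<Sum>j=1..n. y j * w k j * c k)"
      by (rule sum.swap)
    finally show ?thesis by (simp add: sum_distrib_right)
  qed
  then show ?thesis
    by (simp add: gu_act_def assms sum_distrib_left sum.distrib[symmetric] algebra_simps)
qed

text \<open>The action is linear, so the coefficients expressing \<open>vs\<close> through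
  \<open>ws\<close> survive it; the factor is the absolute value of their determinant, the same for
  all t and y.\<close>

lemma gu_norm_proportional:
  assumes "length vs = length ws" "length ws \<le> Suc n" "span_le vs ws"
  shows "\<exists>c. \<forall>t y. gu_norm n t y vs = c * gu_norm n t y ws"
proof -
  obtain c where c: "\<And>b i. b < length vs \<Longrightarrow> rvec (vs ! b) i = (\<Sum>k<length ws. rvec (ws ! k) i * c k b)"
    using span_le_coeff[OF assms(3)] by blast
  have "gu_norm n t y vs = \<bar>ldet (length ws) c\<bar> * gu_norm n t y ws" for t y
  proof -
    have "wedge_norm n (map (\<lambda>v. gu_act n t y (rvec v)) vs) =
       \<bar>ldet (length (map (\<lambda>v. gu_act n t y (rvec v)) ws)) c\<bar> * wedge_norm n (map (\<lambda>v. gu_act n t y (rvec v)) ws)"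
    proof (rule wedge_norm_linear)
      fix b i assume b: "b < length (map (\<lambda>v. gu_act n t y (rvec v)) ws)"
      then show "(map (\<lambda>v. gu_act n t y (rvec v)) vs ! b) i =
         (\<Sum>k<length (map (\<lambda>v. gu_act n t y (rvec v)) ws). (map (\<lambda>v. gu_act n t y (rvec v)) ws ! k) i * c k b)"
        using gu_act_sum[of "rvec (vs ! b)" "\<lambda>k. rvec (ws ! k)" "\<lambda>k. c k b"] c assms(1) by simp
    qed (use assms in auto)
    then show ?thesis by (simp add: gu_norm_rvec)
  qed
  then show ?thesis by blast
qed

lemma indep_Cons:
  assumes "indep vs" "\<not> in_span vs v"
  shows "indep (v # vs)"
  unfolding indep_def
proof (intro allI impI)
  fix c :: "nat \<Rightarrow> real" and k
  assume c: "\<forall>i. (\<Sum>k<length (v # vs). c k * rvec ((v # vs) ! k) i) = 0" and k: "k < length (v # vs)"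
  have eq: "c 0 * rvec v i + (\<Sum>k<length vs. c (Suc k) * rvec (vs ! k) i) = 0" for i
    using c[rule_format, of i] by (simp add: sum.lessThan_Suc_shift del: sum.lessThan_Suc)
  have "c 0 = 0"
  proof (rule ccontr)
    assume c0: "c 0 \<noteq> 0"
    have "rvec v i = (\<Sum>k<length vs. rvec (vs ! k) i * (- c (Suc k) / c 0))" for i
    proof -
      have "(\<Sum>k<length vs. rvec (vs ! k) i * (- c (Suc k) / c 0)) =
            - (\<Sum>k<length vs. c (Suc k) * rvec (vs ! k) i) / c 0"
        by (simp add: sum_negf[symmetric] sum_divide_distrib mult.commute)
      also have "\<dots> = rvec v i"
        using eq[of i] c0 by (simp add: field_simps)
      finally show ?thesis by simp
    qed
    then have "in_span vs v" by (rule in_spanI)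
    then show False using assms(2) by simp
  qed
  then have "\<forall>k<length vs. c (Suc k) = 0"
    using eq assms(1)[unfolded indep_def, rule_format, of "\<lambda>k. c (Suc k)"] by simp
  then show "c k = 0"
    using k \<open>c 0 = 0\<close> by (cases k) auto
qed

text \<open>The matrix \<open>H\<close> of the action is upper triangular with determinant e^t times
  the product of the e^(-t_i), that is 1. The only minor is therefore a nonzero integer.\<close>

lemma full_rank_wedge_norm_ge_1:
  assumes "length vs = Suc n" "\<forall>v\<in>set vs. \<forall>i>n. v i = 0" "indep vs"
  shows "1 \<le> wedge_norm n (map (\<lambda>v. gu_act n t y (rvec v)) vs)"
proof -
  define H :: "nat \<Rightarrow> nat \<Rightarrow> real" where
    "H a c = (if a = 0 then exp (\<Sum>j=1..n. t j) * (if c = 0 then 1 else y c)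
              else if c = a then exp (- t a) else 0)" for a c
  define A where "A a b = rvec (vs ! b) a" for a b
  let ?ws = "map (\<lambda>v. gu_act n t y (rvec v)) vs"
  have H: "gu_act n t y v a = (\<Sum>c<Suc n. H a c * v c)" if "a < Suc n" for a v
  proof (cases "a = 0")
    case True
    have "(\<Sum>c<Suc n. H a c * v c) = exp (\<Sum>j=1..n. t j) * (v 0 + (\<Sum>c<n. y (Suc c) * v (Suc c)))"
      unfolding H_def using True
      by (simp add: sum.lessThan_Suc_shift sum_distrib_left algebra_simps del: sum.lessThan_Suc)
    also have "(\<Sum>c<n. y (Suc c) * v (Suc c)) = (\<Sum>j=1..n. y j * v j)"
      by (simp add: sum.atLeast1_atMost_eq)
    finally show ?thesis
      using True by (simp add: gu_act_def)
  next
    case False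
    have "(\<Sum>c<Suc n. H a c * v c) = (\<Sum>c<Suc n. if c = a then exp (- t a) * v a else 0)"
      using False by (intro sum.cong) (auto simp: H_def)
    then show ?thesis
      using False that by (simp add: gu_act_def del: sum.lessThan_Suc)
  qed
  have sorted: "sorted_list_of_set {0..n} = [0..<Suc n]"
    by (metis atLeastLessThanSuc_atLeastAtMost sorted_list_of_set_range)
  have "minor ?ws {0..n} = ldet (Suc n) (\<lambda>a b. \<Sum>c<Suc n. H a c * A c b)"
    unfolding minor_def sorted
    by (simp add: assms(1) A_def del: sum.lessThan_Suc upt_Suc, rule ldet_cong)
       (simp add: assms(1) H del: sum.lessThan_Suc upt_Suc)
  also have "\<dots> = ldet (Suc n) H * ldet (Suc n) A"
    by (rule ldet_mult)
  also have "ldet (Suc n) H = 1"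
  proof -
    have "ldet (Suc n) H = (\<Prod>a<Suc n. H a a)"
      by (rule ldet_upper_triangular) (auto simp: H_def)
    also have "\<dots> = exp (\<Sum>j=1..n. t j) * (\<Prod>a<n. exp (- t (Suc a)))"
      by (simp add: prod.lessThan_Suc_shift H_def del: prod.lessThan_Suc)
    also have "(\<Prod>a<n. exp (- t (Suc a))) = exp (- (\<Sum>j=1..n. t j))"
      by (simp add: exp_sum[symmetric] sum_negf sum.atLeast1_atMost_eq)
    finally show ?thesis by (simp add: exp_minus)
  qed
  finally have minor_eq: "minor ?ws {0..n} = ldet (Suc n) A" by simp
  have nz: "ldet (Suc n) A \<noteq> 0"
  proof (rule coeff_det_nonzero[where V = "\<lambda>b. rvec (vs ! b)" and W = "\<lambda>a i. if i = a then 1 else 0"])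
    show "\<forall>b<Suc n. d b = 0" if "\<And>i. (\<Sum>b<Suc n. d b * rvec (vs ! b) i) = 0" for d
      using assms(3) that unfolding indep_def assms(1) by blast
    fix b i assume b: "b < Suc n"
    have "(\<Sum>a<Suc n. (if i = a then 1 else 0) * A a b) = (\<Sum>a<Suc n. if a = i then rvec (vs ! b) i else 0)"
      by (rule sum.cong) (auto simp: A_def)
    also have "\<dots> = (if i < Suc n then rvec (vs ! b) i else 0)"
      by (simp del: sum.lessThan_Suc)
    also have "\<dots> = rvec (vs ! b) i"
    proof -
      have "vs ! b \<in> set vs"
        using b assms(1) by simp
      then show ?thesis
        using assms(2) by (auto simp: rvec_def)
    qed
    finally show "rvec (vs ! b) i = (\<Sum>a<Suc n. (if i = a then 1 else 0) * A a b)" by simp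
  qed
  define z where "z = (\<Sum>p | p permutes {..<Suc n}. sign p * (\<Prod>a<Suc n. (vs ! p a) a))"
  have z: "ldet (Suc n) A = of_int z"
    by (simp add: z_def ldet_def A_def rvec_def del: prod.lessThan_Suc)
  have "z \<noteq> 0"
    using nz z by simp
  then have "1 \<le> \<bar>ldet (Suc n) A\<bar>"
    unfolding z by (cases "z \<le> -1") auto
  also have "\<dots> \<le> wedge_norm n ?ws"
    unfolding minor_eq[symmetric] by (rule abs_minor_le_wedge_norm) (simp_all add: assms(1))
  finally show ?thesis .
qed

section \<open>Affine dependence of the wedge coordinates on y\<close>

definition affine_fun :: "nat \<Rightarrow> ((nat \<Rightarrow> real) \<Rightarrow> real) \<Rightarrow> bool" where
  "affine_fun n g \<longleftrightarrow> (\<exists>c0 c. \<forall>y. g y = c0 + (\<Sum>i=1..n. c i * y i))"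

lemma affine_funI: "(\<And>y. g y = c0 + (\<Sum>i=1..n. c i * y i)) \<Longrightarrow> affine_fun n g"
  unfolding affine_fun_def by (intro exI[of _ c0] exI[of _ c]) simp

lemma affine_fun_const: "affine_fun n (\<lambda>y. a)"
  unfolding affine_fun_def by (intro exI[of _ a] exI[of _ "\<lambda>_. 0"]) simp

lemma affine_fun_add:
  assumes "affine_fun n g" "affine_fun n h"
  shows "affine_fun n (\<lambda>y. g y + h y)"
proof -
  obtain c0 c d0 d where "\<And>y. g y = c0 + (\<Sum>i=1..n. c i * y i)" "\<And>y. h y = d0 + (\<Sum>i=1..n. d i * y i)"
    using assms unfolding affine_fun_def by blast
  then show ?thesis
    unfolding affine_fun_def
    by (intro exI[of _ "c0 + d0"] exI[of _ "\<lambda>i. c i + d i"]) (simp add: sum.distrib algebra_simps)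
qed

lemma affine_fun_cmult:
  assumes "affine_fun n g"
  shows "affine_fun n (\<lambda>y. a * g y)"
proof -
  obtain c0 c where "\<And>y. g y = c0 + (\<Sum>i=1..n. c i * y i)"
    using assms unfolding affine_fun_def by blast
  then show ?thesis
    unfolding affine_fun_def
    by (intro exI[of _ "a * c0"] exI[of _ "\<lambda>i. a * c i"]) (simp add: sum_distrib_left algebra_simps)
qed

lemma affine_fun_sum: "(\<And>p. p \<in> S \<Longrightarrow> affine_fun n (g p)) \<Longrightarrow> affine_fun n (\<lambda>y. \<Sum>p\<in>S. g p y)"
proof (induction S rule: infinite_finite_induct)
  case (insert p S)
  then have "affine_fun n (\<lambda>y. g p y + (\<Sum>p\<in>S. g p y))"
    by (intro affine_fun_add) simp_all
  then show ?case using insert.hyps by simp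
next
  case empty
  then show ?case using affine_fun_const[of n 0] by simp
next
  case (infinite S)
  then show ?case using affine_fun_const[of n 0] by simp
qed

lemma affine_fun_gu_act: "affine_fun n (\<lambda>y. gu_act n t y v i)"
proof (cases "i = 0")
  case True
  have "gu_act n t y v i = exp (\<Sum>j=1..n. t j) * v 0 + (\<Sum>j=1..n. (exp (\<Sum>j=1..n. t j) * v j) * y j)" for y
    using True by (simp add: gu_act_def sum_distrib_left algebra_simps)
  then show ?thesis
    by (rule affine_funI)
next
  case False
  then show ?thesis
    using affine_fun_const by (simp add: gu_act_def)
qed

text \<open>Only the row of index 0 depends on \<open>y\<close>, so each minor is affine in \<open>y\<close>.\<close>

lemma affine_fun_minor:
  assumes "finite I" "card I = length vs"
  shows "affine_fun n (\<lambda>y. minor (map (\<lambda>v. gu_act n t y (rvec v)) vs) I)"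
proof -
  let ?k = "length vs"
  define r where "r a = sorted_list_of_set I ! a" for a
  define e where "e y a b = gu_act n t y (rvec (vs ! b)) (r a)" for y a b
  have indep0: "e y a b = e (\<lambda>_. 0) a b" if "r a \<noteq> 0" for y a b
    using that by (simp add: e_def gu_act_def)
  have inj: "a = a'" if "a < ?k" "a' < ?k" "r a = r a'" for a a'
    using that assms by (simp add: r_def nth_eq_iff_index_eq)
  have "affine_fun n (\<lambda>y. \<Prod>a<?k. e y a (p a))" for p
  proof (cases "\<exists>a0<?k. r a0 = 0")
    case True
    then obtain a0 where a0: "a0 < ?k" "r a0 = 0" by blast
    have "(\<Prod>a<?k. e y a (p a)) = (\<Prod>a\<in>{..<?k} - {a0}. e (\<lambda>_. 0) a (p a)) * e y a0 (p a0)" for y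
    proof -
      have "(\<Prod>a<?k. e y a (p a)) = e y a0 (p a0) * (\<Prod>a\<in>{..<?k} - {a0}. e y a (p a))"
        using a0(1) by (simp add: prod.remove)
      also have "(\<Prod>a\<in>{..<?k} - {a0}. e y a (p a)) = (\<Prod>a\<in>{..<?k} - {a0}. e (\<lambda>_. 0) a (p a))"
      proof (rule prod.cong)
        fix a assume "a \<in> {..<?k} - {a0}"
        then have "r a \<noteq> 0" using inj[of a a0] a0 by auto
        then show "e y a (p a) = e (\<lambda>_. 0) a (p a)" by (rule indep0)
      qed simp
      finally show ?thesis by (simp add: mult.commute)
    qed
    then show ?thesis
      using affine_fun_cmult[OF affine_fun_gu_act] by (simp add: e_def)
  next
    case False
    have "(\<Prod>a<?k. e y a (p a)) = (\<Prod>a<?k. e (\<lambda>_. 0) a (p a))" for y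
      using False by (intro prod.cong indep0) auto
    then have "(\<lambda>y. \<Prod>a<?k. e y a (p a)) = (\<lambda>y. \<Prod>a<?k. e (\<lambda>_. 0) a (p a))"
      by (rule ext)
    then show ?thesis
      by (metis affine_fun_const)
  qed
  then have "affine_fun n (\<lambda>y. \<Sum>p | p permutes {..<?k}. of_int (sign p) * (\<Prod>a<?k. e y a (p a)))"
    by (intro affine_fun_sum affine_fun_cmult[of n "\<lambda>y. \<Prod>a<?k. e y a (p a)" for p]) simp
  moreover have "minor (map (\<lambda>v. gu_act n t y (rvec v)) vs) I =
      (\<Sum>p | p permutes {..<?k}. of_int (sign p) * (\<Prod>a<?k. e y a (p a)))" for y
  proof -
    have "minor (map (\<lambda>v. gu_act n t y (rvec v)) vs) I = ldet ?k (e y)"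
      unfolding minor_def by (simp, rule ldet_cong) (simp add: e_def r_def)
    then show ?thesis by (simp add: ldet_def)
  qed
  ultimately show ?thesis by simp
qed

section \<open>Measure estimates and the equivalences\<close>

text \<open>Let \<open>s\<close> be the longest of the members and the empty list whose span omits
  \<open>v\<close>. Longer members contain both \<open>s\<close> and \<open>v\<close>, the others
  lie in the span of \<open>s\<close>; so \<open>v # s\<close> has full rank, or the span of a
  member, or it is comparable to the whole chain. Its covolume is at least \<epsilon> \<rho> / K in
  each case. Dividing by the covolume of \<open>s\<close>, at most K, and by the n + 1 of
  \<open>wedge_norm_Cons_le\<close> gives the constant.\<close>

lemma chain_imp_no_short_vector:
  assumes G: "\<forall>s\<in>G. S_basis n s"
    and chain: "\<And>s u. s \<in> G \<Longrightarrow> u \<in> G \<Longrightarrow> s \<noteq> u \<Longrightarrow>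
      (length s < length u \<and> span_le s u) \<or> (length u < length s \<and> span_le u s)"
    and ext: "\<And>s. S_basis n s \<Longrightarrow>
      \<forall>u\<in>G. (length s < length u \<and> span_le s u) \<or> (length u < length s \<and> span_le u s) \<Longrightarrow>
      \<rho> \<le> gu_norm n t y s"
    and up: "\<And>s. s \<in> G \<Longrightarrow> gu_norm n t y s \<le> K * \<rho>"
    and lower: "\<And>s u. s \<in> G \<Longrightarrow> S_basis n u \<Longrightarrow> length u = length s \<Longrightarrow> span_le u s \<Longrightarrow>
      \<epsilon> * \<rho> / K \<le> gu_norm n t y u"
    and bds: "1 \<le> K" "0 < \<rho>" "\<rho> \<le> 1" "0 < \<epsilon>" "\<epsilon> \<le> 1"
    and v: "\<forall>i>n. v i = 0" "v \<noteq> (\<lambda>_. 0)"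
  shows "\<epsilon> * \<rho> / (K * K * (real n + 1)) \<le> vnorm n (gu_act n t y (rvec v))"
proof -
  have Gn: "1 \<le> length s" "length s \<le> n" "\<forall>v\<in>set s. \<forall>i>n. v i = 0" "indep s" if "s \<in> G" for s
    using G that by (auto simp: S_basis_iff)
  have "[] \<in> insert [] G \<and> \<not> in_span [] v"
    using v(2) by (simp add: in_span_Nil)
  moreover have "\<forall>u. u \<in> insert [] G \<and> \<not> in_span u v \<longrightarrow> length u < Suc n"
    using Gn(2) by force
  ultimately obtain s where s: "s \<in> insert [] G" "\<not> in_span s v"
    and greatest: "\<And>u. u \<in> insert [] G \<Longrightarrow> \<not> in_span u v \<Longrightarrow> length u \<le> length s"
    using ex_has_greatest_nat[of "\<lambda>u. u \<in> insert [] G \<and> \<not> in_span u v" "[]" length "Suc n"] by blast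
  have s_props: "length s \<le> n" "\<forall>v\<in>set s. \<forall>i>n. v i = 0" "indep s"
    using s(1) Gn by (auto simp: indep_def)
  define ws where "ws = v # s"
  have ws: "length ws = Suc (length s)" "\<forall>v\<in>set ws. \<forall>i>n. v i = 0" "indep ws"
    using s_props v(1) indep_Cons[OF s_props(3) s(2)] by (auto simp: ws_def)
  have small: "\<epsilon> * \<rho> / K \<le> 1"
  proof -
    have "\<epsilon> * \<rho> \<le> 1 * 1"
      using bds by (intro mult_mono) auto
    then show ?thesis using bds(1) by simp
  qed
  have "\<epsilon> * \<rho> / K \<le> gu_norm n t y ws"
  proof (cases "length ws = Suc n")
    case True
    then show ?thesis
      using full_rank_wedge_norm_ge_1[OF True ws(2,3), of t y] small by (simp add: gu_norm_rvec)
  next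
    case False
    then have Sws: "S_basis n ws"
      using ws s_props(1) by (simp add: S_basis_iff)
    have cmp: "(length u < length ws \<and> span_le u ws) \<or> (length ws \<le> length u \<and> span_le ws u)"
      if u: "u \<in> G" for u
    proof (cases "length u \<le> length s")
      case True
      then have "s \<in> G"
        using s(1) Gn(1)[OF u] by auto
      then have "span_le u s"
        using True chain[OF u, of s] by (cases "u = s") (auto simp: span_le_def intro: in_span_mem)
      then have "span_le u ws"
        unfolding ws_def using span_le_Cons_right by (rule span_le_trans)
      then show ?thesis
        using True ws(1) by simp
    next
      case False
      then have "in_span u v"
        using greatest[of u] u by auto
      moreover have "span_le s u"
        using s(1) False chain[OF _ u, of s] by (cases "s = []") (auto simp: span_le_def)
      ultimately have "span_le ws u"
        by (simp add: ws_def span_le_def)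
      then show ?thesis
        using False ws(1) by simp
    qed
    show ?thesis
    proof (cases "\<exists>u\<in>G. length u = length ws")
      case True
      then obtain u where u: "u \<in> G" "length u = length ws" by blast
      then have "span_le ws u"
        using cmp[OF u(1)] by simp
      then show ?thesis
        using lower[OF u(1) Sws] u(2) by simp
    next
      case False
      then have "\<rho> \<le> gu_norm n t y ws"
        using cmp by (intro ext[OF Sws]) (metis le_neq_implies_less)
      moreover have "\<epsilon> * \<rho> / K \<le> \<rho>"
      proof -
        have "\<epsilon> * \<rho> \<le> 1 * \<rho>"
          using bds by (intro mult_right_mono) auto
        also have "\<dots> \<le> K * \<rho>"
          using bds by (intro mult_right_mono) auto
        finally show ?thesis
          using bds(1) by (simp add: field_simps)
      qed
      ultimately show ?thesis by linarith
    qed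
  qed
  also have "gu_norm n t y ws \<le> (real n + 1) * vnorm n (gu_act n t y (rvec v)) * gu_norm n t y s"
    unfolding gu_norm_rvec ws_def using s_props(1) by (simp add: wedge_norm_Cons_le)
  also have "\<dots> \<le> (real n + 1) * vnorm n (gu_act n t y (rvec v)) * K"
  proof (rule mult_left_mono)
    have "K * \<rho> \<le> K * 1"
      using bds by (intro mult_left_mono) auto
    moreover have "gu_norm n t y s \<le> K * \<rho>" if "s \<noteq> []"
      using s(1) that up[of s] by simp
    moreover have "gu_norm n t y s \<le> K" if "s = []"
      using that bds(1) by (simp add: gu_norm_rvec)
    ultimately show "gu_norm n t y s \<le> K"
      by linarith
  qed (simp add: vnorm_nonneg)
  finally have "\<epsilon> * \<rho> \<le> (real n + 1) * vnorm n (gu_act n t y (rvec v)) * K * K"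
    using bds(1) by (simp add: pos_divide_le_eq)
  moreover have "0 < K * K * (real n + 1)"
    using bds(1) by simp
  ultimately show ?thesis
    by (simp only: pos_divide_le_eq mult_ac)
qed

section \<open>Goodness of the covolume functions\<close>

lemma pgood_of_good_on:
  fixes h :: "'a::euclidean_space \<Rightarrow> real"
  assumes "open V" "continuous_on V h" "good_on C \<alpha> V h"
  shows "pgood C \<alpha> V h"
  unfolding pgood_def
proof (intro allI impI ballI)
  fix z :: 'a and r \<epsilon> :: real and y
  assume r: "0 < r" "ball z r \<subseteq> V" and \<epsilon>: "0 < \<epsilon>" and y: "y \<in> ball z r"
  have cont: "continuous_on V (\<lambda>x. \<bar>h x\<bar>)"
    using assms(2) by (intro continuous_intros)
  define A where "A = ereal \<epsilon> * (SUP y\<in>ball z r. ereal \<bar>h y\<bar>)"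
  have "ereal \<bar>h y\<bar> \<le> (SUP y\<in>ball z r. ereal \<bar>h y\<bar>)"
    using y by (rule SUP_upper)
  then have "ereal \<epsilon> * ereal \<bar>h y\<bar> \<le> A"
    unfolding A_def using \<epsilon> by (intro ereal_mult_left_mono) auto
  then have "{x \<in> ball z r. \<bar>h x\<bar> < \<epsilon> * \<bar>h y\<bar>} \<subseteq> {x \<in> ball z r. ereal \<bar>h x\<bar> < A}"
  proof (intro subsetI CollectI conjI; elim CollectE conjE)
    fix x assume "\<bar>h x\<bar> < \<epsilon> * \<bar>h y\<bar>"
    then have "ereal \<bar>h x\<bar> < ereal \<epsilon> * ereal \<bar>h y\<bar>" by simp
    then show "ereal \<bar>h x\<bar> < A"
      using \<open>ereal \<epsilon> * ereal \<bar>h y\<bar> \<le> A\<close> by (rule less_le_trans)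
  qed
  \<comment> \<open>The supremum may be infinite on an open ball; the sublevel set is then the ball
    itself.\<close>
  moreover have "{x \<in> ball z r. ereal \<bar>h x\<bar> < A} \<in> lmeasurable"
  proof (cases A)
    case (real a)
    then show ?thesis
      using lmeasurable_sublevel[OF assms(1) cont r(2), of a] by simp
  next
    case PInf
    then have "{x \<in> ball z r. ereal \<bar>h x\<bar> < A} = ball z r" by auto
    then show ?thesis by simp
  next
    case MInf
    then show ?thesis by simp
  qed
  moreover have "{x \<in> ball z r. \<bar>h x\<bar> < \<epsilon> * \<bar>h y\<bar>} \<in> sets lebesgue"
    using lmeasurable_sublevel[OF assms(1) cont r(2)] by blast
  ultimately have "measure lebesgue {x \<in> ball z r. \<bar>h x\<bar> < \<epsilon> * \<bar>h y\<bar>} \<le>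
      measure lebesgue {x \<in> ball z r. ereal \<bar>h x\<bar> < A}"
    by (intro measure_mono_fmeasurable)
  also have "\<dots> \<le> C * \<epsilon> powr \<alpha> * measure lebesgue (ball z r)"
    using assms(3) r \<epsilon> unfolding good_on_def A_def by blast
  finally show "measure lebesgue {x \<in> ball z r. \<bar>h x\<bar> < \<epsilon> * \<bar>h y\<bar>} \<le> C * \<epsilon> powr \<alpha> * measure lebesgue (ball z r)" .
qed

lemma continuous_on_Max_abs:
  fixes g :: "'i \<Rightarrow> 'a::topological_space \<Rightarrow> real"
  assumes "finite J" "J \<noteq> {}" "\<And>I. I \<in> J \<Longrightarrow> continuous_on V (g I)"
  shows "continuous_on V (\<lambda>x. Max ((\<lambda>I. \<bar>g I x\<bar>) ` J))"
  using assms
proof (induction J rule: finite_ne_induct)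
  case (singleton I)
  then show ?case by (auto intro!: continuous_intros)
next
  case (insert I J)
  then have "continuous_on V (\<lambda>x. max \<bar>g I x\<bar> (Max ((\<lambda>I. \<bar>g I x\<bar>) ` J)))"
    by (intro continuous_on_max continuous_on_rabs) auto
  then show ?case
    using insert.hyps by simp
qed

text \<open>Take the index that attains the maximum at \<open>y\<close>: the threshold becomes that
  of a single good function, and the sublevel set of the maximum is contained in the one of that
  function. The constants do not change.\<close>

lemma pgood_Max_abs:
  fixes g :: "'i \<Rightarrow> 'a::euclidean_space \<Rightarrow> real"
  assumes "open V" "finite J" "J \<noteq> {}"
    and cont: "\<And>I. I \<in> J \<Longrightarrow> continuous_on V (g I)" and good: "\<And>I. I \<in> J \<Longrightarrow> pgood C \<alpha> V (g I)"
  shows "pgood C \<alpha> V (\<lambda>x. Max ((\<lambda>I. \<bar>g I x\<bar>) ` J))"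
  unfolding pgood_def
proof (intro allI impI ballI)
  let ?M = "\<lambda>x. Max ((\<lambda>I. \<bar>g I x\<bar>) ` J)"
  fix z :: 'a and r \<epsilon> :: real and y
  assume r: "0 < r" "ball z r \<subseteq> V" and \<epsilon>: "0 < \<epsilon>" and y: "y \<in> ball z r"
  have ge: "\<bar>g I x\<bar> \<le> ?M x" if "I \<in> J" for I x
    using that assms(2) by (intro Max_ge) auto
  obtain I where I: "I \<in> J" "?M y = \<bar>g I y\<bar>"
    using Max_in[of "(\<lambda>I. \<bar>g I y\<bar>) ` J"] assms(2,3)
    by (metis (mono_tags, lifting) finite_imageI image_iff image_is_empty)
  have M0: "0 \<le> ?M x" for x
    using ge[OF I(1), of x] by linarith
  have contI: "continuous_on V (\<lambda>x. \<bar>g I x\<bar>)"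
    using cont[OF I(1)] by (intro continuous_intros)
  have contM: "continuous_on V ?M"
    by (rule continuous_on_Max_abs[OF assms(2,3) cont])
  have "measure lebesgue {x \<in> ball z r. ?M x < \<epsilon> * \<bar>g I y\<bar>} \<le>
        measure lebesgue {x \<in> ball z r. \<bar>g I x\<bar> < \<epsilon> * \<bar>g I y\<bar>}"
  proof (rule measure_mono_fmeasurable)
    show "{x \<in> ball z r. ?M x < \<epsilon> * \<bar>g I y\<bar>} \<subseteq> {x \<in> ball z r. \<bar>g I x\<bar> < \<epsilon> * \<bar>g I y\<bar>}"
      using le_less_trans[OF ge[OF I(1)]] by blast
    show "{x \<in> ball z r. ?M x < \<epsilon> * \<bar>g I y\<bar>} \<in> sets lebesgue"
      using lmeasurable_sublevel[OF assms(1) contM r(2)] by blast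
    show "{x \<in> ball z r. \<bar>g I x\<bar> < \<epsilon> * \<bar>g I y\<bar>} \<in> lmeasurable"
      by (rule lmeasurable_sublevel[OF assms(1) contI r(2)])
  qed
  also have "\<dots> \<le> C * \<epsilon> powr \<alpha> * measure lebesgue (ball z r)"
    using good[OF I(1)] r \<epsilon> y unfolding pgood_def by blast
  finally show "measure lebesgue {x \<in> ball z r. \<bar>?M x\<bar> < \<epsilon> * \<bar>?M y\<bar>} \<le> C * \<epsilon> powr \<alpha> * measure lebesgue (ball z r)"
    using I(2) M0 by (simp only: abs_of_nonneg abs_abs abs_idempotent)
qed

text \<open>The coordinates are affine in \<open>f x\<close>, hence good with the given constants
  whatever t and the subgroup are.\<close>

lemma gu_norm_good:
  fixes f :: "'a::euclidean_space \<Rightarrow> nat \<Rightarrow> real"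
  assumes "open V" and cont: "\<forall>i\<in>{1..n}. continuous_on V (\<lambda>x. f x i)"
    and good: "\<forall>c0 c. good_on C \<alpha> V (\<lambda>x. c0 + (\<Sum>i=1..n. c i * f x i))"
    and len: "length vs \<le> Suc n"
  shows "continuous_on V (\<lambda>x. gu_norm n t (f x) vs)" "pgood C \<alpha> V (\<lambda>x. gu_norm n t (f x) vs)"
proof -
  define J where "J = {I. I \<subseteq> {0..n} \<and> card I = length vs}"
  define g where "g I x = minor (map (\<lambda>v. gu_act n t (f x) (rvec v)) vs) I" for I x
  have "length vs \<le> card {0..n}"
    using len by simp
  then obtain I0 where "I0 \<subseteq> {0..n}" "card I0 = length vs"
    by (rule obtain_subset_with_card_n)
  then have "I0 \<in> J"
    by (simp add: J_def)
  then have J: "finite J" "J \<noteq> {}"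
    unfolding J_def using finite_card_subsets by auto
  have eq: "(\<lambda>x. gu_norm n t (f x) vs) = (\<lambda>x. Max ((\<lambda>I. \<bar>g I x\<bar>) ` J))"
    by (simp add: gu_norm_rvec wedge_norm_minor g_def J_def)
  have g: "continuous_on V (g I) \<and> pgood C \<alpha> V (g I)" if "I \<in> J" for I
  proof -
    have "finite I" "card I = length vs"
      using that finite_subset by (auto simp: J_def)
    from affine_fun_minor[OF this, of n t] obtain c0 c where
      "\<And>y. minor (map (\<lambda>v. gu_act n t y (rvec v)) vs) I = c0 + (\<Sum>i=1..n. c i * y i)"
      unfolding affine_fun_def by blast
    then have gI: "g I = (\<lambda>x. c0 + (\<Sum>i=1..n. c i * f x i))"
      by (simp add: g_def fun_eq_iff)
    have "continuous_on V (g I)"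
      unfolding gI using cont by (intro continuous_intros) auto
    then show ?thesis
      using pgood_of_good_on[OF assms(1)] good gI by metis
  qed
  show "continuous_on V (\<lambda>x. gu_norm n t (f x) vs)"
    unfolding eq using g by (intro continuous_on_Max_abs J) auto
  show "pgood C \<alpha> V (\<lambda>x. gu_norm n t (f x) vs)"
    unfolding eq using g by (intro pgood_Max_abs assms(1) J) auto
qed

lemma ex_doubling_const:
  assumes "0 < C" "0 < \<alpha>"
  shows "\<exists>K\<ge>1. C * (1 / K) powr \<alpha> * 10 ^ d < (1::real)"
proof -
  \<comment> \<open>With K^\<alpha> \<ge> b the product is at most 1/2.\<close>
  define b where "b = 2 * C * 10 ^ d"
  define K where "K = max 1 (b powr (1 / \<alpha>))"
  have b: "0 < b"
    using assms(1) by (simp add: b_def)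
  have "(b powr (1 / \<alpha>)) powr \<alpha> \<le> K powr \<alpha>"
    using assms(2) by (intro powr_mono2) (auto simp: K_def)
  then have bK: "b \<le> K powr \<alpha>"
    using b assms(2) by (simp add: powr_powr)
  have "1 \<le> K" by (simp add: K_def)
  moreover have "C * (1 / K) powr \<alpha> * 10 ^ d = b / 2 / (K powr \<alpha>)"
    using \<open>1 \<le> K\<close> by (simp add: b_def powr_divide)
  moreover have "b / 2 / (K powr \<alpha>) < 1"
    using bK b by (simp add: divide_less_eq)
  ultimately show ?thesis by metis
qed

definition has_short :: "nat \<Rightarrow> (nat \<Rightarrow> real) \<Rightarrow> (nat \<Rightarrow> real) \<Rightarrow> real \<Rightarrow> bool" where
  "has_short n t y \<delta> \<longleftrightarrow> (\<exists>v. (\<forall>i>n. v i = 0) \<and> v \<noteq> (\<lambda>_. 0) \<and> vnorm n (gu_act n t y (rvec v)) < \<delta>)"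

text \<open>\<open>A\<close> and \<open>K\<close> are chosen before t, the ball, \<rho> and
  \<epsilon>; this uniformity makes summation over all times possible. The argument starts from the
  empty flag, for which every basis is an extension.\<close>

lemma short_vectors_measure:
  fixes f :: "'a::euclidean_space \<Rightarrow> nat \<Rightarrow> real"
  assumes "open V" and cont: "\<forall>i\<in>{1..n}. continuous_on V (\<lambda>x. f x i)"
    and good: "\<forall>c0 c. good_on C \<alpha> V (\<lambda>x. c0 + (\<Sum>i=1..n. c i * f x i))"
    and "0 < C" "0 < \<alpha>"
  obtains A K where "0 \<le> A" "1 \<le> K"
    "\<forall>t z r \<rho> \<epsilon>. 0 < r \<longrightarrow> ball z (21 ^ n * r) \<subseteq> V \<longrightarrow> 0 < \<rho> \<longrightarrow> \<rho> \<le> 1 \<longrightarrow> 0 < \<epsilon> \<longrightarrow> \<epsilon> \<le> 1 \<longrightarrow>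
     (\<forall>vs. S_basis n vs \<longrightarrow> (\<exists>x\<in>ball z r. \<rho> \<le> gu_norm n t (f x) vs)) \<longrightarrow>
     (\<exists>N\<in>lmeasurable. {x \<in> ball z r. has_short n t (f x) (\<epsilon> * \<rho> / (K * K * (real n + 1)))} \<subseteq> N \<and>
       measure lebesgue N \<le> A * \<epsilon> powr \<alpha> * measure lebesgue (ball z r))"
proof -
  obtain K where K: "1 \<le> K" "C * (1 / K) powr \<alpha> * 10 ^ DIM('a) < 1"
    using ex_doubling_const[OF assms(4,5)] by blast
  have main: "\<exists>N\<in>lmeasurable. {x \<in> ball z r. has_short n t (f x) (\<epsilon> * \<rho> / (K * K * (real n + 1)))} \<subseteq> N \<and>
       measure lebesgue N \<le> nd_const C DIM('a) n * \<epsilon> powr \<alpha> * measure lebesgue (ball z r)"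
    if r: "0 < r" "ball z (21 ^ n * r) \<subseteq> V" and \<rho>: "0 < \<rho>" "\<rho> \<le> 1" and \<epsilon>: "0 < \<epsilon>" "\<epsilon> \<le> 1"
      and large: "\<forall>vs. S_basis n vs \<longrightarrow> (\<exists>x\<in>ball z r. \<rho> \<le> gu_norm n t (f x) vs)" for t z r \<rho> \<epsilon>
  proof -
    let ?P = "{vs. S_basis n vs}"
    let ?\<psi> = "\<lambda>vs x. gu_norm n t (f x) vs"
    have P: "1 \<le> length vs" "length vs \<le> n" "indep vs" if "vs \<in> ?P" for vs
      using that by (auto simp: S_basis_iff)
    interpret nondivergence V C \<alpha> K n ?P length span_le ?\<psi>
    proof
      fix vs assume vs: "vs \<in> ?P"
      show "continuous_on V (?\<psi> vs)" "pgood C \<alpha> V (?\<psi> vs)"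
        using gu_norm_good[OF assms(1) cont good, of vs t] P(2)[OF vs] by auto
      show "0 \<le> ?\<psi> vs x" for x
        using P(2)[OF vs] by (simp add: gu_norm_rvec wedge_norm_nonneg)
      show "length vs \<in> {1..n}"
        using P[OF vs] by simp
    next
      show "span_le us ws" if "span_le us vs" "span_le vs ws" for us vs ws
        using that by (rule span_le_trans)
    next
      show "span_le ws vs" if "vs \<in> ?P" "length vs = length ws" "span_le vs ws" for vs ws
        using P(3)[OF that(1)] that(2,3) by (rule span_le_sym)
    next
      show "\<exists>c. \<forall>x. ?\<psi> vs x = c * ?\<psi> ws x"
        if "ws \<in> ?P" "length vs = length ws" "span_le vs ws" for vs ws
        using gu_norm_proportional[OF that(2) _ that(3), of n] P(2)[OF that(1)] by auto
    qed (use assms K in auto)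
    have "flag {}" "\<forall>u\<in>ext {}. \<exists>y\<in>ball z r. \<rho> \<le> ?\<psi> u y"
      using large by (auto simp: flag_def ext_def)
    then obtain N where N: "N \<in> lmeasurable" "{x \<in> ball z r. \<not> marked {} \<rho> \<epsilon> x} \<subseteq> N"
      "measure lebesgue N \<le> nd_const C DIM('a) n * \<epsilon> powr \<alpha> * measure lebesgue (ball z r)"
      using unmarked_measure[of "{}" n r z \<rho> \<epsilon>] r \<rho> \<epsilon> by auto
    have "\<epsilon> * \<rho> / (K * K * (real n + 1)) \<le> vnorm n (gu_act n t (f x) (rvec v))"
      if m: "marked {} \<rho> \<epsilon> x" and v: "\<forall>i>n. v i = 0" "v \<noteq> (\<lambda>_. 0)" for x v
    proof -
      obtain G where G: "flag G" "\<forall>s\<in>ext G. \<rho> \<le> ?\<psi> s x"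
        "\<forall>s\<in>G. ?\<psi> s x \<le> K * \<rho> \<and> (\<forall>u\<in>?P. length u = length s \<longrightarrow> span_le u s \<longrightarrow> \<epsilon> * \<rho> / K \<le> ?\<psi> u x)"
        using m unfolding marked_def Diff_empty by blast
      show ?thesis
      proof (rule chain_imp_no_short_vector[of G])
        show "\<forall>s\<in>G. S_basis n s"
          using G(1) by (auto simp: flag_def)
        show "(length s < length u \<and> span_le s u) \<or> (length u < length s \<and> span_le u s)"
          if "s \<in> G" "u \<in> G" "s \<noteq> u" for s u
          using G(1) that by (simp add: flag_def cmp_def)
        show "\<rho> \<le> gu_norm n t (f x) s" if "S_basis n s"
          "\<forall>u\<in>G. (length s < length u \<and> span_le s u) \<or> (length u < length s \<and> span_le u s)" for s
          using G(2) that by (simp add: ext_def cmp_def)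
      qed (use G(3) v K \<rho> \<epsilon> in auto)
    qed
    then have "{x \<in> ball z r. has_short n t (f x) (\<epsilon> * \<rho> / (K * K * (real n + 1)))} \<subseteq> N"
      using N(2) by (auto simp: has_short_def not_less[symmetric])
    then show ?thesis
      using N(1,3) by blast
  qed
  show ?thesis
  proof (rule that)
    show "0 \<le> nd_const C DIM('a) n"
      using assms(4) by (simp add: nd_const_nonneg)
  qed (use K(1) main in blast)+
qed

section \<open>Summation over integral times and Borel--Cantelli\<close>

lemma power_le_fact_exp:
  fixes x :: real
  assumes "0 \<le> x"
  shows "x ^ n \<le> fact n * exp x"
proof -
  have "(\<Sum>k\<in>{n}. x ^ k /\<^sub>R fact k) \<le> (\<Sum>k. x ^ k /\<^sub>R fact k)"
    using assms by (intro sum_le_suminf summable_exp_generic) auto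
  then have "x ^ n / fact n \<le> exp x"
    by (simp add: exp_def divide_inverse mult.commute)
  then show ?thesis
    by (simp add: divide_le_eq mult.commute)
qed

text \<open>The inequality x^n \<le> n! e^x at x = c (k + 1) / 2 trades the polynomial for half of
  the decay and leaves a geometric series.\<close>

lemma summable_power_exp:
  fixes c :: real
  assumes "0 < c"
  shows "summable (\<lambda>k. real (Suc k) ^ n * exp (- c * real k))"
proof (rule summable_comparison_test')
  define D where "D = fact n * (2 / c) ^ n * exp (c / 2)"
  show "summable (\<lambda>k. D * exp (- (c / 2)) ^ k)"
    using assms by (intro summable_mult summable_geometric) auto
  fix k :: nat
  have "(c / 2 * real (Suc k)) ^ n \<le> fact n * exp (c / 2 * real (Suc k))"
    using assms by (intro power_le_fact_exp) auto
  then have "(2 / c) ^ n * (c / 2 * real (Suc k)) ^ n \<le> (2 / c) ^ n * (fact n * exp (c / 2 * real (Suc k)))"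
    using assms by (intro mult_left_mono) auto
  also have "(2 / c) ^ n * (c / 2 * real (Suc k)) ^ n = real (Suc k) ^ n"
    using assms by (simp add: power_mult_distrib[symmetric] del: of_nat_Suc)
  finally have "real (Suc k) ^ n \<le> (2 / c) ^ n * (fact n * exp (c / 2 * real (Suc k)))" .
  then have "real (Suc k) ^ n * exp (- c * real k) \<le>
      (2 / c) ^ n * (fact n * exp (c / 2 * real (Suc k))) * exp (- c * real k)"
    by (intro mult_right_mono) auto
  also have "\<dots> = (2 / c) ^ n * fact n * exp (c / 2 * real (Suc k) + - c * real k)"
    by (simp only: exp_add mult_ac)
  also have "c / 2 * real (Suc k) + - c * real k = c / 2 + real k * - (c / 2)"
    by (simp add: field_simps)
  also have "(2 / c) ^ n * fact n * exp (c / 2 + real k * - (c / 2)) = D * exp (- (c / 2)) ^ k"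
    by (simp only: D_def exp_add exp_of_nat_mult mult_ac)
  finally show "norm (real (Suc k) ^ n * exp (- c * real k)) \<le> D * exp (- (c / 2)) ^ k"
    by simp
qed

lemma gu_act_cong:
  assumes "\<And>i. i \<in> {1..n} \<Longrightarrow> t i = t' i"
  shows "gu_act n t y v = gu_act n t' y v"
proof -
  have "sum t {1..n} = sum t' {1..n}"
    using assms by (intro sum.cong) auto
  then show ?thesis
    using assms by (auto simp: gu_act_def fun_eq_iff)
qed

text \<open>Half of the bound lies strictly below the supremum, so a point of \<open>B\<close>
  realizes it.\<close>

lemma cond_star_lower_bound:
  assumes "cond_star n f B" "0 < \<beta>"
  shows "\<exists>T>0. \<forall>t. (\<forall>i\<in>{1..n}. 0 \<le> t i) \<longrightarrow> T \<le> (\<Sum>i=1..n. t i) \<longrightarrow>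
     (\<forall>vs. S_basis n vs \<longrightarrow> (\<exists>x\<in>B. exp (- \<beta> * (\<Sum>i=1..n. t i)) / 2 \<le> gu_norm n t (f x) vs))"
proof -
  obtain T where T: "0 < T" "\<forall>t. (\<forall>i\<in>{1..n}. 0 \<le> t i) \<longrightarrow> T \<le> (\<Sum>i=1..n. t i) \<longrightarrow> (\<forall>vs. S_basis n vs \<longrightarrow>
      ereal (exp (- \<beta> * (\<Sum>i=1..n. t i))) \<le> (SUP x\<in>B. ereal (gu_norm n t (f x) vs)))"
    using assms(1)[unfolded cond_star_def, rule_format, OF assms(2)] by (elim exE conjE)
  have "\<exists>x\<in>B. exp (- \<beta> * (\<Sum>i=1..n. t i)) / 2 \<le> gu_norm n t (f x) vs"
    if "\<forall>i\<in>{1..n}. 0 \<le> t i" "T \<le> (\<Sum>i=1..n. t i)" "S_basis n vs" for t vs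
  proof -
    have "ereal (exp (- \<beta> * (\<Sum>i=1..n. t i)) / 2) < ereal (exp (- \<beta> * (\<Sum>i=1..n. t i)))"
      by simp
    also have "\<dots> \<le> (SUP x\<in>B. ereal (gu_norm n t (f x) vs))"
      by (rule T(2)[rule_format, OF _ that(2,3)]) (use that(1) in simp)
    finally obtain x where "x \<in> B" "exp (- \<beta> * (\<Sum>i=1..n. t i)) / 2 < gu_norm n t (f x) vs"
      unfolding less_SUP_iff by auto
    then show ?thesis by (intro bexI[of _ x]) auto
  qed
  then show ?thesis
    using T(1) by (intro exI[of _ T]) simp
qed

lemma AE_eventually_no_short_vectors:
  fixes f :: "'a::euclidean_space \<Rightarrow> nat \<Rightarrow> real"
  assumes "open V" and cont: "\<forall>i\<in>{1..n}. continuous_on V (\<lambda>x. f x i)"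
    and good: "\<forall>c0 c. good_on C \<alpha> V (\<lambda>x. c0 + (\<Sum>i=1..n. c i * f x i))"
    and "0 < C" "0 < \<alpha>" and r: "0 < r" "ball z (21 ^ n * r) \<subseteq> V"
    and star: "cond_star n f (ball z r)" and "0 < \<beta>"
  shows "AE x in lebesgue. x \<in> ball z r \<longrightarrow> (\<exists>T. \<forall>\<tau>::nat \<Rightarrow> nat. T \<le> (\<Sum>i=1..n. \<tau> i) \<longrightarrow>
    \<not> has_short n (\<lambda>i. real (\<tau> i)) (f x) (2 * exp (- (2 * \<beta>) * real (\<Sum>i=1..n. \<tau> i))))"
proof -
  let ?B = "ball z r"
  let ?b = "\<lambda>\<tau>::nat \<Rightarrow> nat. 2 * exp (- (2 * \<beta>) * real (\<Sum>i=1..n. \<tau> i))"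
  obtain A K where A: "0 \<le> A" and K: "1 \<le> K" and AK: "\<forall>t z r \<rho> \<epsilon>. 0 < r \<longrightarrow> ball z (21 ^ n * r) \<subseteq> V \<longrightarrow> 0 < \<rho> \<longrightarrow> \<rho> \<le> 1 \<longrightarrow> 0 < \<epsilon> \<longrightarrow> \<epsilon> \<le> 1 \<longrightarrow>
     (\<forall>vs. S_basis n vs \<longrightarrow> (\<exists>x\<in>ball z r. \<rho> \<le> gu_norm n t (f x) vs)) \<longrightarrow>
     (\<exists>N\<in>lmeasurable. {x \<in> ball z r. has_short n t (f x) (\<epsilon> * \<rho> / (K * K * (real n + 1)))} \<subseteq> N \<and>
       measure lebesgue N \<le> A * \<epsilon> powr \<alpha> * measure lebesgue (ball z r))"
    by (rule short_vectors_measure[OF assms(1) cont good assms(4,5)])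
  obtain T where T: "0 < T" "\<forall>t. (\<forall>i\<in>{1..n}. 0 \<le> t i) \<longrightarrow> T \<le> (\<Sum>i=1..n. t i) \<longrightarrow> (\<forall>vs. S_basis n vs \<longrightarrow>
      (\<exists>x\<in>?B. exp (- \<beta> * (\<Sum>i=1..n. t i)) / 2 \<le> gu_norm n t (f x) vs))"
    using cond_star_lower_bound[OF star \<open>0 < \<beta>\<close>] by (elim exE conjE)
  \<comment> \<open>With \<epsilon> = M e^(-\<beta> k), the length \<epsilon> \<rho> / (K K (n + 1))
    becomes 2 e^(-2 \<beta> k).\<close>
  define M where "M = 4 * (K * K * (real n + 1))"
  have M: "0 < M"
    using K by (simp add: M_def)
  define k0 where "k0 = nat \<lceil>max T (ln M / \<beta>)\<rceil>"
  define D where "D = A * M powr \<alpha> * measure lebesgue ?B"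
  have D: "0 \<le> D"
    using A by (simp add: D_def)
  have one: "\<exists>N\<in>lmeasurable. {x \<in> ?B. has_short n (\<lambda>i. real (\<tau> i)) (f x) (?b \<tau>)} \<subseteq> N \<and>
       measure lebesgue N \<le> D * exp (- (\<alpha> * \<beta>) * real k)"
    if k: "k0 \<le> k" "(\<Sum>i=1..n. \<tau> i) = k" for \<tau> :: "nat \<Rightarrow> nat" and k
  proof -
    have "max T (ln M / \<beta>) \<le> real k"
      using k(1) unfolding k0_def by linarith
    then have Tk: "T \<le> real k" and "ln M \<le> \<beta> * real k"
      using \<open>0 < \<beta>\<close> by (auto simp: divide_le_eq mult.commute)
    then have "M \<le> exp (\<beta> * real k)"
      using M by (metis exp_le_cancel_iff exp_ln)
    then have eps1: "M * exp (- \<beta> * real k) \<le> 1"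
      by (simp add: exp_minus divide_inverse[symmetric] divide_le_eq)
    have sum: "(\<Sum>i=1..n. real (\<tau> i)) = real k"
      using k(2) by (simp flip: of_nat_sum)
    define \<rho> where "\<rho> = exp (- \<beta> * real k) / 2"
    define \<epsilon> where "\<epsilon> = M * exp (- \<beta> * real k)"
    have "exp (- \<beta> * real k) \<le> 1"
      using \<open>0 < \<beta>\<close> by simp
    then have \<rho>: "0 < \<rho>" "\<rho> \<le> 1"
      using exp_gt_zero[of "- \<beta> * real k"] unfolding \<rho>_def by linarith+
    have \<epsilon>: "0 < \<epsilon>" "\<epsilon> \<le> 1"
      using M eps1 by (auto simp: \<epsilon>_def)
    have "\<forall>vs. S_basis n vs \<longrightarrow> (\<exists>x\<in>?B. \<rho> \<le> gu_norm n (\<lambda>i. real (\<tau> i)) (f x) vs)"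
      using T(2)[rule_format, of "\<lambda>i. real (\<tau> i)"] Tk unfolding sum \<rho>_def by simp
    from AK[rule_format, OF r \<rho> \<epsilon> this[rule_format]] obtain N where N: "N \<in> lmeasurable"
      "{x \<in> ?B. has_short n (\<lambda>i. real (\<tau> i)) (f x) (\<epsilon> * \<rho> / (K * K * (real n + 1)))} \<subseteq> N"
      "measure lebesgue N \<le> A * \<epsilon> powr \<alpha> * measure lebesgue ?B" by blast
    have "\<epsilon> * \<rho> / (K * K * (real n + 1)) = 2 * (exp (- \<beta> * real k) * exp (- \<beta> * real k))"
    proof -
      have "4 * q * e * (e / 2) / q = 2 * (e * e)" if "q \<noteq> 0" for q e :: real
        using that by simp
      moreover have "K * K * (real n + 1) \<noteq> 0"
        using K by simp
      ultimately show ?thesis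
        unfolding \<epsilon>_def \<rho>_def M_def by blast
    qed
    also have "\<dots> = ?b \<tau>"
      unfolding k(2) by (simp add: exp_add[symmetric])
    finally have b: "\<epsilon> * \<rho> / (K * K * (real n + 1)) = ?b \<tau>" .
    have "\<epsilon> powr \<alpha> = M powr \<alpha> * exp (- (\<alpha> * \<beta>) * real k)"
      using M by (simp add: \<epsilon>_def powr_mult exp_powr_real mult_ac)
    then have "measure lebesgue N \<le> D * exp (- (\<alpha> * \<beta>) * real k)"
      using N(3) by (simp add: D_def mult_ac)
    then show ?thesis
      using N(1,2) unfolding b by blast
  qed
  \<comment> \<open>Entries of a time with sum k are at most k. Extensional functions make the set
    finite, so an arbitrary \<tau> is later replaced by its restriction to {1..n}.\<close>
  define F where "F k = {\<tau> \<in> {1..n} \<rightarrow>\<^sub>E {..k}. (\<Sum>i=1..n. \<tau> i) = k}" for k :: nat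
  have F: "finite (F k)" "real (card (F k)) \<le> real (Suc k) ^ n" for k
  proof -
    have fin: "finite ({1..n} \<rightarrow>\<^sub>E {..k})"
      by (intro finite_PiE) auto
    show "finite (F k)"
      unfolding F_def using fin by simp
    have "card (F k) \<le> card ({1..n} \<rightarrow>\<^sub>E {..k})"
      unfolding F_def using fin by (intro card_mono) auto
    also have "\<dots> = Suc k ^ n"
      by (simp add: card_PiE)
    finally have "card (F k) \<le> Suc k ^ n" .
    then show "real (card (F k)) \<le> real (Suc k) ^ n"
      by (metis of_nat_le_iff of_nat_power)
  qed
  have "\<exists>N. N \<in> lmeasurable \<and> measure lebesgue N \<le> D * (real (Suc k) ^ n * exp (- (\<alpha> * \<beta>) * real k)) \<and>
     (k0 \<le> k \<longrightarrow> (\<forall>\<tau>\<in>F k. {x \<in> ?B. has_short n (\<lambda>i. real (\<tau> i)) (f x) (?b \<tau>)} \<subseteq> N))" for k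
  proof (cases "k0 \<le> k")
    case False
    then show ?thesis
      using D by (intro exI[of _ "{}"]) auto
  next
    case True
    then have "\<forall>\<tau>\<in>F k. \<exists>N\<in>lmeasurable. {x \<in> ?B. has_short n (\<lambda>i. real (\<tau> i)) (f x) (?b \<tau>)} \<subseteq> N \<and>
       measure lebesgue N \<le> D * exp (- (\<alpha> * \<beta>) * real k)"
      using one[OF True] by (simp add: F_def)
    then have "\<forall>\<tau>\<in>F k. \<exists>N. N \<in> lmeasurable \<and> {x \<in> ?B. has_short n (\<lambda>i. real (\<tau> i)) (f x) (?b \<tau>)} \<subseteq> N \<and>
       measure lebesgue N \<le> D * exp (- (\<alpha> * \<beta>) * real k)"
      by blast
    from bchoice[OF this] obtain N where N: "\<forall>\<tau>\<in>F k. N \<tau> \<in> lmeasurable \<and>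
       {x \<in> ?B. has_short n (\<lambda>i. real (\<tau> i)) (f x) (?b \<tau>)} \<subseteq> N \<tau> \<and>
       measure lebesgue (N \<tau>) \<le> D * exp (- (\<alpha> * \<beta>) * real k)"
      by (elim exE)
    have "measure lebesgue (\<Union>\<tau>\<in>F k. N \<tau>) \<le> (\<Sum>\<tau>\<in>F k. measure lebesgue (N \<tau>))"
      using N by (intro measure_UNION_le F(1)) auto
    also have "\<dots> \<le> (\<Sum>\<tau>\<in>F k. D * exp (- (\<alpha> * \<beta>) * real k))"
      using N by (intro sum_mono) auto
    also have "\<dots> = real (card (F k)) * (D * exp (- (\<alpha> * \<beta>) * real k))"
      by simp
    also have "\<dots> \<le> real (Suc k) ^ n * (D * exp (- (\<alpha> * \<beta>) * real k))"
      using D by (intro mult_right_mono F(2)) auto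
    finally have "measure lebesgue (\<Union>\<tau>\<in>F k. N \<tau>) \<le> D * (real (Suc k) ^ n * exp (- (\<alpha> * \<beta>) * real k))"
      by (simp only: mult_ac)
    moreover have "(\<Union>\<tau>\<in>F k. N \<tau>) \<in> lmeasurable"
      using N F(1) by (intro fmeasurable.finite_UN) auto
    ultimately show ?thesis
      using N by (intro exI[of _ "\<Union>\<tau>\<in>F k. N \<tau>"]) auto
  qed
  then have "\<forall>k. \<exists>N. N \<in> lmeasurable \<and> measure lebesgue N \<le> D * (real (Suc k) ^ n * exp (- (\<alpha> * \<beta>) * real k)) \<and>
     (k0 \<le> k \<longrightarrow> (\<forall>\<tau>\<in>F k. {x \<in> ?B. has_short n (\<lambda>i. real (\<tau> i)) (f x) (?b \<tau>)} \<subseteq> N))" by (rule allI)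
  from choice[OF this] obtain N where N': "\<forall>k. N k \<in> lmeasurable \<and>
     measure lebesgue (N k) \<le> D * (real (Suc k) ^ n * exp (- (\<alpha> * \<beta>) * real k)) \<and>
     (k0 \<le> k \<longrightarrow> (\<forall>\<tau>\<in>F k. {x \<in> ?B. has_short n (\<lambda>i. real (\<tau> i)) (f x) (?b \<tau>)} \<subseteq> N k))"
    by (elim exE)
  have N: "N k \<in> lmeasurable"
    "measure lebesgue (N k) \<le> D * (real (Suc k) ^ n * exp (- (\<alpha> * \<beta>) * real k))"
    "k0 \<le> k \<Longrightarrow> \<tau> \<in> F k \<Longrightarrow> {x \<in> ?B. has_short n (\<lambda>i. real (\<tau> i)) (f x) (?b \<tau>)} \<subseteq> N k" for k \<tau>
    using N'[rule_format, of k] by blast+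
  have "AE x in lebesgue. eventually (\<lambda>k. x \<in> space lebesgue - N k) sequentially"
  proof (rule borel_cantelli_AE1)
    show "N k \<in> sets lebesgue" "emeasure lebesgue (N k) < \<infinity>" for k
      using N(1)[of k] by (auto simp: fmeasurable_def)
    show "summable (\<lambda>k. measure lebesgue (N k))"
    proof (rule summable_comparison_test')
      show "summable (\<lambda>k. D * (real (Suc k) ^ n * exp (- (\<alpha> * \<beta>) * real k)))"
        using \<open>0 < \<alpha>\<close> \<open>0 < \<beta>\<close> by (intro summable_mult summable_power_exp) simp
      show "norm (measure lebesgue (N k)) \<le> D * (real (Suc k) ^ n * exp (- (\<alpha> * \<beta>) * real k))" for k
        using N(2)[of k] by simp
    qed
  qed
  then show ?thesis
  proof (rule AE_mp, intro AE_I2 impI)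
    fix x assume ev: "eventually (\<lambda>k. x \<in> space lebesgue - N k) sequentially" and x: "x \<in> ?B"
    then obtain k1 where k1: "\<And>k. k1 \<le> k \<Longrightarrow> x \<notin> N k"
      by (auto simp: eventually_sequentially)
    have "\<not> has_short n (\<lambda>i. real (\<tau> i)) (f x) (?b \<tau>)"
      if \<tau>: "max k0 k1 \<le> (\<Sum>i=1..n. \<tau> i)" for \<tau> :: "nat \<Rightarrow> nat"
    proof
      assume short: "has_short n (\<lambda>i. real (\<tau> i)) (f x) (?b \<tau>)"
      define k where "k = (\<Sum>i=1..n. \<tau> i)"
      define \<sigma> where "\<sigma> = restrict \<tau> {1..n}"
      have \<sigma>_eq: "\<sigma> i = \<tau> i" if "i \<in> {1..n}" for i
        using that by (simp add: \<sigma>_def)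
      have sum\<sigma>: "(\<Sum>i=1..n. \<sigma> i) = k"
        unfolding k_def by (rule sum.cong) (auto simp: \<sigma>_eq)
      have "\<tau> i \<le> k" if "i \<in> {1..n}" for i
        unfolding k_def using that by (intro member_le_sum) auto
      then have "\<sigma> \<in> F k"
        using sum\<sigma> by (auto simp: F_def \<sigma>_def)
      moreover have "has_short n (\<lambda>i. real (\<sigma> i)) (f x) (?b \<sigma>)"
      proof -
        have "gu_act n (\<lambda>i. real (\<sigma> i)) (f x) v = gu_act n (\<lambda>i. real (\<tau> i)) (f x) v" for v
          by (rule gu_act_cong) (simp add: \<sigma>_eq)
        then show ?thesis
          using short unfolding has_short_def sum\<sigma> k_def by simp
      qed
      ultimately have "x \<in> N k"
        using N(3)[of k \<sigma>] \<tau> x unfolding k_def by auto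
      then show False
        using k1[of k] \<tau> by (simp add: k_def)
    qed
    then show "\<exists>T. \<forall>\<tau>::nat \<Rightarrow> nat. T \<le> (\<Sum>i=1..n. \<tau> i) \<longrightarrow> \<not> has_short n (\<lambda>i. real (\<tau> i)) (f x) (?b \<tau>)"
      by blast
  qed
qed

text \<open>The rate \<gamma> of the contracted vectors depends on x, so the previous bound is used
  for the countably many \<beta> = 1/(m + 1), one of which has 2 \<beta> \<le> \<gamma>. The factor
  2 in the length gives the strict inequality in \<open>has_short\<close>.\<close>

lemma AE_ball_not_VWMA:
  fixes f :: "'a::euclidean_space \<Rightarrow> nat \<Rightarrow> real"
  assumes "n \<ge> 1" "open V" and cont: "\<forall>i\<in>{1..n}. continuous_on V (\<lambda>x. f x i)"
    and good: "\<forall>c0 c. good_on C \<alpha> V (\<lambda>x. c0 + (\<Sum>i=1..n. c i * f x i))"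
    and "0 < C" "0 < \<alpha>" and r: "0 < r" "ball z (21 ^ n * r) \<subseteq> V"
    and star: "cond_star n f (ball z r)"
  shows "AE x in lebesgue. x \<in> ball z r \<longrightarrow> \<not> VWMA n (f x)"
proof -
  have "AE x in lebesgue. \<forall>m. x \<in> ball z r \<longrightarrow> (\<exists>T. \<forall>\<tau>::nat \<Rightarrow> nat. T \<le> (\<Sum>i=1..n. \<tau> i) \<longrightarrow>
    \<not> has_short n (\<lambda>i. real (\<tau> i)) (f x) (2 * exp (- (2 * (1 / real (Suc m))) * real (\<Sum>i=1..n. \<tau> i))))"
    unfolding AE_all_countable
    by (intro allI AE_eventually_no_short_vectors[OF assms(2) cont good assms(5,6) r star]) simp
  then show ?thesis
  proof (rule AE_mp, intro AE_I2 impI notI)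
    fix x assume no: "\<forall>m. x \<in> ball z r \<longrightarrow> (\<exists>T. \<forall>\<tau>::nat \<Rightarrow> nat. T \<le> (\<Sum>i=1..n. \<tau> i) \<longrightarrow>
      \<not> has_short n (\<lambda>i. real (\<tau> i)) (f x) (2 * exp (- (2 * (1 / real (Suc m))) * real (\<Sum>i=1..n. \<tau> i))))"
      and x: "x \<in> ball z r" and "VWMA n (f x)"
    from VWMA_imp_short_vectors[OF assms(1) \<open>VWMA n (f x)\<close>]
    obtain \<gamma> where \<gamma>: "0 < \<gamma>" and short: "\<forall>T. \<exists>\<tau>::nat \<Rightarrow> nat. T \<le> (\<Sum>i=1..n. \<tau> i) \<and>
      (\<exists>v. (\<forall>i>n. v i = 0) \<and> v \<noteq> (\<lambda>_. 0) \<and>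
        vnorm n (gu_act n (\<lambda>i. real (\<tau> i)) (f x) (rvec v)) \<le> exp (- \<gamma> * real (\<Sum>i=1..n. \<tau> i)))"
      by (elim exE conjE)
    obtain m where m: "inverse (real (Suc m)) < \<gamma> / 2"
      using reals_Archimedean[of "\<gamma> / 2"] \<gamma> by auto
    from no[rule_format, OF x, of m] obtain T where T: "\<forall>\<tau>::nat \<Rightarrow> nat. T \<le> (\<Sum>i=1..n. \<tau> i) \<longrightarrow>
      \<not> has_short n (\<lambda>i. real (\<tau> i)) (f x) (2 * exp (- (2 * (1 / real (Suc m))) * real (\<Sum>i=1..n. \<tau> i)))"
      by (elim exE)
    from short[rule_format, of T] obtain \<tau> v where \<tau>: "T \<le> (\<Sum>i=1..n. \<tau> i)"
      and v: "\<forall>i>n. v i = 0" "v \<noteq> (\<lambda>_. 0)"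
      "vnorm n (gu_act n (\<lambda>i. real (\<tau> i)) (f x) (rvec v)) \<le> exp (- \<gamma> * real (\<Sum>i=1..n. \<tau> i))"
      by (elim exE conjE)
    define s where "s = real (\<Sum>i=1..n. \<tau> i)"
    have "2 * (1 / real (Suc m)) \<le> \<gamma>"
      using m unfolding inverse_eq_divide by linarith
    then have "- \<gamma> * s \<le> - (2 * (1 / real (Suc m))) * s"
      unfolding s_def by (intro mult_right_mono of_nat_0_le_iff) simp
    then have "exp (- \<gamma> * s) \<le> exp (- (2 * (1 / real (Suc m))) * s)"
      by (simp only: exp_le_cancel_iff)
    also have "\<dots> < 2 * exp (- (2 * (1 / real (Suc m))) * s)"
      using exp_gt_zero[of "- (2 * (1 / real (Suc m))) * s"] by linarith
    finally have "has_short n (\<lambda>i. real (\<tau> i)) (f x) (2 * exp (- (2 * (1 / real (Suc m))) * s))"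
      using v unfolding has_short_def s_def[symmetric] by (intro exI[of _ v] conjI) (assumption | linarith)+
    then show False
      using T[rule_format, OF \<tau>] by (simp only: s_def)
  qed
qed

text \<open>By Lindelof, countably many of the open sets on which \<open>P\<close> holds almost
  everywhere cover the union of all of them, and this union contains almost every point of
  \<open>U\<close>.\<close>

lemma AE_lebesgue_local:
  fixes U :: "'a::euclidean_space set"
  assumes "AE x0 in lebesgue. x0 \<in> U \<longrightarrow> (\<exists>W. open W \<and> x0 \<in> W \<and> (AE x in lebesgue. x \<in> W \<longrightarrow> P x))"
  shows "AE x in lebesgue. x \<in> U \<longrightarrow> P x"
proof -
  define \<F> where "\<F> = {W::'a set. open W \<and> (AE x in lebesgue. x \<in> W \<longrightarrow> P x)}"
  obtain \<G> where \<G>: "\<G> \<subseteq> \<F>" "countable \<G>" "\<Union>\<G> = \<Union>\<F>"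
    using Lindelof[of \<F>] by (auto simp: \<F>_def)
  have "AE x in lebesgue. \<forall>W\<in>\<G>. x \<in> W \<longrightarrow> P x"
    using \<G>(1,2) by (intro AE_ball_countable') (auto simp: \<F>_def)
  with assms show ?thesis
  proof eventually_elim
    case (elim x)
    show ?case
    proof
      assume "x \<in> U"
      then have "x \<in> \<Union>\<F>"
        using elim(1) by (auto simp: \<F>_def)
      then show "P x"
        using elim(2) \<G>(3) by blast
    qed
  qed
qed

text \<open>A point of \<open>U\<close> outside the closure would have a ball of exceptions, which
  has positive measure.\<close>

lemma AE_imp_dense:
  fixes U :: "'a::euclidean_space set"
  assumes "open U" "AE x in lebesgue. x \<in> U \<longrightarrow> P x"
  shows "U \<subseteq> closure {x \<in> U. P x}"
proof
  fix x assume "x \<in> U"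
  show "x \<in> closure {x \<in> U. P x}"
  proof (rule ccontr)
    assume "x \<notin> closure {x \<in> U. P x}"
    then have "open (U - closure {x \<in> U. P x})" "x \<in> U - closure {x \<in> U. P x}"
      using assms(1) \<open>x \<in> U\<close> by auto
    then obtain e where e: "0 < e" "ball x e \<subseteq> U - closure {x \<in> U. P x}"
      by (meson open_contains_ball)
    have "AE y in lebesgue. y \<notin> ball x e"
      using assms(2)
    proof eventually_elim
      case (elim y)
      then show ?case
        using e(2) closure_subset[of "{x \<in> U. P x}"] by blast
    qed
    then have "ball x e \<in> null_sets lebesgue"
      by (subst AE_iff_null_sets) auto
    then have "measure lebesgue (ball x e) = 0"
      by (simp add: measure_eq_0_null_sets)
    then show False
      using measure_ball_pos[OF e(1), of x] by simp
  qed
qed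

theorem theorem5p3:
  fixes U :: "'a::euclidean_space set" and f :: "'a \<Rightarrow> nat \<Rightarrow> real" and n :: nat
  assumes "n \<ge> 1" and "open U"
    and "\<forall>i\<in>{1..n}. continuous_on U (\<lambda>x. f x i)"
    and "good n U f"
  shows "(U \<subseteq> closure {x \<in> U. \<not> VWMA n (f x)} \<longleftrightarrow> strongly_extremal n U f)
       \<and> (strongly_extremal n U f \<longleftrightarrow>
            (AE x0 in lebesgue. x0 \<in> U \<longrightarrow>
               (\<forall>r>0. \<exists>\<rho>. 0 < \<rho> \<and> \<rho> < r \<and> ball x0 \<rho> \<subseteq> U \<and> cond_star n f (ball x0 \<rho>))))
       \<and> ((AE x0 in lebesgue. x0 \<in> U \<longrightarrow>
               (\<forall>r>0. \<exists>\<rho>. 0 < \<rho> \<and> \<rho> < r \<and> ball x0 \<rho> \<subseteq> U \<and> cond_star n f (ball x0 \<rho>)))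
            \<longleftrightarrow> (\<forall>z \<rho>. 0 < \<rho> \<longrightarrow> ball z \<rho> \<subseteq> U \<longrightarrow> cond_star n f (ball z \<rho>)))"
proof -
  let ?i = "U \<subseteq> closure {x \<in> U. \<not> VWMA n (f x)}"
  let ?iii = "AE x0 in lebesgue. x0 \<in> U \<longrightarrow>
    (\<forall>r>0. \<exists>\<rho>. 0 < \<rho> \<and> \<rho> < r \<and> ball x0 \<rho> \<subseteq> U \<and> cond_star n f (ball x0 \<rho>))"
  let ?iv = "\<forall>z \<rho>. 0 < \<rho> \<longrightarrow> ball z \<rho> \<subseteq> U \<longrightarrow> cond_star n f (ball z \<rho>)"
  have iv_iii: ?iii if ?iv
  proof (rule AE_I2, intro impI allI)
    fix x0 and r :: real assume "x0 \<in> U" "0 < r"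
    then obtain e where e: "0 < e" "ball x0 e \<subseteq> U"
      using assms(2) by (meson open_contains_ball)
    define \<rho> where "\<rho> = min e (r / 2)"
    have \<rho>: "0 < \<rho>" "\<rho> < r" "\<rho> \<le> e"
      using e(1) \<open>0 < r\<close> by (auto simp: \<rho>_def)
    have "ball x0 \<rho> \<subseteq> U"
      using e(2) \<rho>(3) by (meson order_trans subset_ball)
    then show "\<exists>\<rho>. 0 < \<rho> \<and> \<rho> < r \<and> ball x0 \<rho> \<subseteq> U \<and> cond_star n f (ball x0 \<rho>)"
      using \<rho> that by blast
  qed
  have iii_ii: "strongly_extremal n U f" if ?iii
    unfolding strongly_extremal_def
  proof (rule AE_lebesgue_local)
    have "AE x0 in lebesgue. x0 \<in> U \<longrightarrow> good_at n U f x0"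
      using assms(4) by (simp add: good_def)
    with that show "AE x0 in lebesgue. x0 \<in> U \<longrightarrow>
        (\<exists>W. open W \<and> x0 \<in> W \<and> (AE x in lebesgue. x \<in> W \<longrightarrow> \<not> VWMA n (f x)))"
    proof eventually_elim
      case (elim x0)
      show ?case
      proof
        assume x0: "x0 \<in> U"
        then obtain V C \<alpha> where V: "open V" "x0 \<in> V" "V \<subseteq> U" "0 < C" "0 < \<alpha>"
          and gd: "\<forall>c0 c. good_on C \<alpha> V (\<lambda>x. c0 + (\<Sum>i=1..n. c i * f x i))"
          using elim(2) unfolding good_at_def by blast
        obtain e where e: "0 < e" "ball x0 e \<subseteq> V"
          using V(1,2) by (meson open_contains_ball)
        \<comment> \<open>Condition (iii) supplies arbitrarily small balls, so the 21^n-fold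
          enlargement used in the nondivergence estimate can be kept inside
          \<open>V\<close>.\<close>
        then have "0 < e / 21 ^ n" by simp
        then obtain \<rho> where \<rho>: "0 < \<rho>" "\<rho> < e / 21 ^ n" "cond_star n f (ball x0 \<rho>)"
          using elim(1) x0 by blast
        have "21 ^ n * \<rho> \<le> e"
          using \<rho>(2) by (simp add: less_divide_eq mult.commute)
        then have "ball x0 (21 ^ n * \<rho>) \<subseteq> V"
          using e(2) by (meson order_trans subset_ball)
        moreover have "\<forall>i\<in>{1..n}. continuous_on V (\<lambda>x. f x i)"
          using assms(3) V(3) continuous_on_subset by blast
        ultimately have "AE x in lebesgue. x \<in> ball x0 \<rho> \<longrightarrow> \<not> VWMA n (f x)"
          using AE_ball_not_VWMA[OF assms(1) V(1) _ gd V(4,5) \<rho>(1) _ \<rho>(3)] by blast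
        then show "\<exists>W. open W \<and> x0 \<in> W \<and> (AE x in lebesgue. x \<in> W \<longrightarrow> \<not> VWMA n (f x))"
          using \<rho>(1) by (intro exI[of _ "ball x0 \<rho>"]) auto
      qed
    qed
  qed
  have ii_i: ?i if "strongly_extremal n U f"
    using AE_imp_dense[OF assms(2)] that unfolding strongly_extremal_def .
  have i_iv: ?iv if ?i
  proof (intro allI impI)
    fix z and \<rho> :: real assume \<rho>: "0 < \<rho>" "ball z \<rho> \<subseteq> U"
    then have "z \<in> closure {x \<in> U. \<not> VWMA n (f x)}"
      using that by (auto simp: subset_iff)
    then obtain x where "dist x z < \<rho>" "\<not> VWMA n (f x)"
      using \<rho>(1) unfolding closure_approachable by blast
    then have x: "x \<in> ball z \<rho>" "\<not> VWMA n (f x)"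
      by (auto simp: dist_commute)
    show "cond_star n f (ball z \<rho>)"
      unfolding cond_star_def
    proof (intro allI impI)
      fix \<beta> :: real assume "0 < \<beta>"
      from not_VWMA_imp_gu_norm_ge[OF assms(1) x(2) this] obtain T where T: "0 < T"
        "\<And>t vs. \<forall>i\<in>{1..n}. 0 \<le> t i \<Longrightarrow> T \<le> (\<Sum>i=1..n. t i) \<Longrightarrow> S_basis n vs \<Longrightarrow>
          exp (- \<beta> * (\<Sum>i=1..n. t i)) \<le> gu_norm n t (f x) vs" by blast
      have "ereal (exp (- \<beta> * (\<Sum>i=1..n. t i))) \<le> (SUP x\<in>ball z \<rho>. ereal (gu_norm n t (f x) vs))"
        if "\<forall>i\<in>{1..n}. 0 \<le> t i" "T \<le> (\<Sum>i=1..n. t i)" "S_basis n vs" for t vs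
        using T(2)[OF that] by (intro SUP_upper2[OF x(1)]) simp
      then show "\<exists>T>0. \<forall>t. (\<forall>i\<in>{1..n}. 0 \<le> t i) \<longrightarrow> (\<Sum>i=1..n. t i) \<ge> T \<longrightarrow> (\<forall>vs. S_basis n vs \<longrightarrow>
          (SUP x\<in>ball z \<rho>. ereal (gu_norm n t (f x) vs)) \<ge> ereal (exp (- \<beta> * (\<Sum>i=1..n. t i))))"
        using T(1) by blast
    qed
  qed
  show ?thesis
    using iv_iii iii_ii ii_i i_iv by blast
qed

end
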